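(* Let $d\geq 3$ and let $\Delta$ be a balanced minimal $(d-1)$-cycle complex. Then $2h_2(\Delta)\geq(d-1)h_1(\Delta)$.
   Context: Simplicial complexes are finite; $[d]=\{1,\dots,d\}$; $V(\Delta)$ is the vertex set. For a collection $\mathcal S$ of finite sets, $\langle\mathcal S\rangle=\{G: G\subseteq F \text{ for some } F\in\mathcal S\}$. For a $(d-1)$-dimensional complex $\Delta$, $f_i(\Delta)$ is the number of $i$-dimensional faces, and $h_j(\Delta)=\sum_{i=0}^j(-1)^{j-i}\binom{d-i}{d-j}f_{i-1}(\Delta)$; in particular $h_1(\Delta)=f_0(\Delta)-d$ and $h_2(\Delta)=f_1(\Delta)-(d-1)f_0(\Delta)+\binom d2$. Minimal cycle complexes. Let $\Gamma$ be an abelian group. On a totally ordered vertex set, an $i$-chain is a formal sum $c=\sum_F a_F F$ of $i$-faces with $a_F\in\Gamma$; $\partial c=\sum_F a_F\,\partial F$, where for $F=\{x_1<\dots<x_{i+1}\}$, $\partial F=\sum_{j=1}^{i+1}(-1)^jF\setminus\{x_j\}$. An $i$-cycle is an $i$-chain $c$ with $\partial c=0$. A chain $c'=\sum b_FF$ is a subchain of $c=\sum a_FF$ if $b_F\in\{0,a_F\}$ for every $F$. An $i$-cycle $c$ is minimal if its only subchains that are $i$-cycles are $c$ and $0$. $\operatorname{supp} c=\{F:a_F\neq0\}$. A $(d-1)$-dimensional simplicial complex $\Delta$ is a minimal $(d-1)$-cycle complex (over $\Gamma$) if either (i) $\Delta=\langle\{F\}\rangle$ for a $d$-set $F$, or (ii)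 $\Delta=\langle\operatorname{supp}c\rangle$ for some nonzero minimal $(d-1)$-cycle $c$ with coefficients in $\Gamma$. Here $\Gamma$ is an arbitrary abelian group. A $(d-1)$-dimensional complex $\Delta$ is balanced if there is a map $\kappa:V(\Delta)\to[d]$ with $|F\cap\kappa^{-1}(i)|\leq1$ for all $F\in\Delta$, $i\in[d]$. *)

theory Defs
  imports "HOL-Library.Poly_Mapping"
begin

definition simplicial_complex :: "'v set set \<Rightarrow> bool" where
  "simplicial_complex \<Delta> \<longleftrightarrow>
     finite \<Delta> \<and> \<Delta> \<noteq> {} \<and> (\<forall>F\<in>\<Delta>. finite F) \<and> (\<forall>F\<in>\<Delta>. \<forall>G. G \<subseteq> F \<longrightarrow> G \<in> \<Delta>)"

definition vertices :: "'v set set \<Rightarrow> 'v set" where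
  "vertices \<Delta> = \<Union>\<Delta>"

text \<open>Integer-valued, so that the complex whose only face is the empty set has dimension -1.\<close>

definition complex_dim :: "'v set set \<Rightarrow> int" where
  "complex_dim \<Delta> = int (Max (card ` \<Delta>)) - 1"

definition generated_complex :: "'v set set \<Rightarrow> 'v set set" where
  "generated_complex S = {G. \<exists>F\<in>S. G \<subseteq> F}"

text \<open>The index is an integer because the h-numbers involve \<open>f_num \<Delta> (- 1)\<close>.\<close>

definition f_num :: "'v set set \<Rightarrow> int \<Rightarrow> nat" where
  "f_num \<Delta> i = card {F \<in> \<Delta>. int (card F) = i + 1}"

text \<open>The h-numbers of a complex of dimension \<open>d - 1\<close>, meant for \<open>j \<le> d\<close>.\<close>

definition h_num :: "nat \<Rightarrow> 'v set set \<Rightarrow> nat \<Rightarrow> int" where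
  "h_num d \<Delta> j =
     (\<Sum>i=0..j. (-1) ^ (j - i) * int ((d - i) choose (d - j)) * int (f_num \<Delta> (int i - 1)))"

text \<open>
  A chain is a finitely supported function from faces to the coefficient group; its support is
  \<open>Poly_Mapping.keys c\<close> and the coefficient of \<open>F\<close> is \<open>Poly_Mapping.lookup c F\<close>. The total order on
  the vertices is that of the class \<open>linorder\<close>.
\<close>

definition is_chain :: "nat \<Rightarrow> ('v set \<Rightarrow>\<^sub>0 'g::ab_group_add) \<Rightarrow> bool" where
  "is_chain i c \<longleftrightarrow> (\<forall>F\<in>Poly_Mapping.keys c. finite F \<and> card F = i + 1)"

text \<open>
  \<open>sorted_list_of_set F ! (j - 1)\<close> is the \<open>j\<close>-th smallest vertex of \<open>F\<close>, counted from 1. The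
  conditional is the action of the sign \<open>(-1) ^ j\<close> on the coefficient group, which carries no
  multiplication.
\<close>

definition boundary :: "('v::linorder set \<Rightarrow>\<^sub>0 'g::ab_group_add) \<Rightarrow> ('v set \<Rightarrow>\<^sub>0 'g)" where
  "boundary c =
     (\<Sum>F\<in>Poly_Mapping.keys c. \<Sum>j=1..card F.
        Poly_Mapping.single (F - {sorted_list_of_set F ! (j - 1)})
          (if even j then Poly_Mapping.lookup c F else - Poly_Mapping.lookup c F))"

definition is_cycle :: "nat \<Rightarrow> ('v::linorder set \<Rightarrow>\<^sub>0 'g::ab_group_add) \<Rightarrow> bool" where
  "is_cycle i c \<longleftrightarrow> is_chain i c \<and> boundary c = 0"

definition subchain :: "('v set \<Rightarrow>\<^sub>0 'g::ab_group_add) \<Rightarrow> ('v set \<Rightarrow>\<^sub>0 'g) \<Rightarrow> bool" where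
  "subchain c' c \<longleftrightarrow> (\<forall>F. Poly_Mapping.lookup c' F \<in> {0, Poly_Mapping.lookup c F})"

definition minimal_cycle :: "nat \<Rightarrow> ('v::linorder set \<Rightarrow>\<^sub>0 'g::ab_group_add) \<Rightarrow> bool" where
  "minimal_cycle i c \<longleftrightarrow>
     is_cycle i c \<and> (\<forall>c'. subchain c' c \<and> is_cycle i c' \<longrightarrow> c' = c \<or> c' = 0)"

text \<open>The first argument only serves to name the coefficient group.\<close>

definition minimal_cycle_complex ::
    "'g::ab_group_add itself \<Rightarrow> nat \<Rightarrow> 'v::linorder set set \<Rightarrow> bool" where
  "minimal_cycle_complex \<Gamma> i \<Delta> \<longleftrightarrow>
     simplicial_complex \<Delta> \<and> complex_dim \<Delta> = int i \<and>
     ((\<exists>F. finite F \<and> card F = i + 1 \<and> \<Delta> = generated_complex {F}) \<or>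
      (\<exists>c :: 'v set \<Rightarrow>\<^sub>0 'g. c \<noteq> 0 \<and> minimal_cycle i c \<and>
         \<Delta> = generated_complex (Poly_Mapping.keys c)))"

definition balanced :: "nat \<Rightarrow> 'v set set \<Rightarrow> bool" where
  "balanced d \<Delta> \<longleftrightarrow>
     simplicial_complex \<Delta> \<and> complex_dim \<Delta> = int d - 1 \<and>
     (\<exists>\<kappa> :: 'v \<Rightarrow> nat. \<kappa> ` vertices \<Delta> \<subseteq> {1..d} \<and>
        (\<forall>F\<in>\<Delta>. \<forall>i\<in>{1..d}. card (F \<inter> \<kappa> -` {i}) \<le> 1))"

lemma f_num_minus_1:
  assumes "simplicial_complex \<Delta>"
  shows "f_num \<Delta> (- 1) = 1"
proof -
  have "{F \<in> \<Delta>. int (card F) = - 1 + 1} = {{}}"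
    using assms unfolding simplicial_complex_def by auto
  then show ?thesis unfolding f_num_def by simp
qed

lemma h_num_1:
  assumes "simplicial_complex \<Delta>" "d \<ge> 1"
  shows "h_num d \<Delta> 1 = int (f_num \<Delta> 0) - int d"
proof -
  have "d choose (d - 1) = d"
    using assms(2) by (metis binomial_symmetric choose_one)
  then show ?thesis
    using f_num_minus_1[OF assms(1)] unfolding h_num_def by (simp add: numeral_2_eq_2)
qed

lemma h_num_2:
  assumes "simplicial_complex \<Delta>" "d \<ge> 2"
  shows "h_num d \<Delta> 2 =
    int (f_num \<Delta> 1) - (int d - 1) * int (f_num \<Delta> 0) + int (d choose 2)"
proof -
  have "d choose (d - 2) = d choose 2"
    using assms(2) by (metis binomial_symmetric)
  moreover have "(d - 1) choose (d - 2) = d - 1"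
    using assms(2) binomial_symmetric[of 1 "d - 1"] by (simp add: numeral_2_eq_2)
  ultimately show ?thesis
    using f_num_minus_1[OF assms(1)] assms(2) unfolding h_num_def
    by (simp add: numeral_2_eq_2 of_nat_diff left_diff_distrib)
qed

end

(*
  For a set T of three colours let A be the set of vertices with colour in T. Every facet has exactly
  three vertices in A. It suffices that the graph induced on A has at least 3|A| - 6 edges: summing
  over all T, an edge is counted d - 2 times and a vertex (d - 1)(d - 2)/2 times.

  The bound on the edges holds because the induced graph is generically rigid in R^3, in the sense of
  Kalai's hyperconnectivity matroid, whose trivial motions form a 6-dimensional space. Rigidity is
  proved by Fogelsanger's decomposition, contracting only edges uv inside A so that facets keep three
  vertices in A. The image of the cycle splits into minimal pieces, rigid by induction; each piece
  lifts back by a vertex split, since the boundary of its lift yields two common neighbours of u and v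
  in A. Minimality of the original cycle shows that the lifts can be glued one after the other along
  u, v and a third vertex of A. Fogelsanger's argument only manipulates subchains, so an arbitrary
  abelian coefficient group causes no trouble.
*)

theory Submission
  imports Defs "HOL-Analysis.Cartesian_Space" "HOL-Computational_Algebra.Polynomial"
begin

section \<open>Rigidity of graphs in three-space\<close>

text \<open>The target is exactly an average of the bounds for single colour triples:
  \<open>2 h_2 - (d-1) h_1 = 2 f_1 - 3 (d-1) f_0 + 2 d (d-1)\<close>, which is
  \<open>2/(d-2)\<close> times the sum over all triples of edges minus three times vertices plus 6.
  One obstacle is that the subcomplex induced on A need not come from a minimal cycle, and that
  contracting an edge need not preserve the colouring. So the induction keeps the whole cycle and
  remembers only that each facet has three vertices in A and \<open>k\<close> outside; these two
  numbers force the common neighbours needed for a vertex split. The other obstacle is that facets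
  may cancel under contraction, so pieces are sets of facets rather than chains. The boundary of the
  lift of a piece lives on faces with exactly one of u, v. If it shared no face with the boundary of
  the lift of the remaining facets, then facets through u and v would close the lift into a proper
  subcycle. Genericity is propagated by linear algebra: one rigid placement is enough, even one with
  u and v at the same point.\<close>

definition polyfun :: "(('v \<Rightarrow> real^3) \<Rightarrow> real) \<Rightarrow> bool" where
  "polyfun f \<longleftrightarrow> (\<forall>p q. \<exists>P. \<forall>t. f (\<lambda>i. p i + t *\<^sub>R q i) = poly P t)"

lemma polyfun_const: "polyfun (\<lambda>p. a)"
  unfolding polyfun_def by (intro allI exI[of _ "[:a:]"]) simp

lemma polyfun_coord: "polyfun (\<lambda>p. p i $ k)"
  unfolding polyfun_def
proof (intro allI)
  fix p q :: "'a \<Rightarrow> real^3"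
  show "\<exists>P. \<forall>t. (p i + t *\<^sub>R q i) $ k = poly P t"
    by (rule exI[of _ "[:p i $ k, q i $ k:]"]) simp
qed

lemma polyfun_mult:
  assumes "polyfun f" "polyfun g"
  shows "polyfun (\<lambda>p. f p * g p)"
  unfolding polyfun_def
proof (intro allI)
  fix p q
  obtain P Q where "\<forall>t. f (\<lambda>i. p i + t *\<^sub>R q i) = poly P t" "\<forall>t. g (\<lambda>i. p i + t *\<^sub>R q i) = poly Q t"
    using assms unfolding polyfun_def by blast
  then show "\<exists>P. \<forall>t. f (\<lambda>i. p i + t *\<^sub>R q i) * g (\<lambda>i. p i + t *\<^sub>R q i) = poly P t"
    by (intro exI[of _ "P * Q"]) simp
qed

lemma polyfun_diff:
  assumes "polyfun f" "polyfun g"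
  shows "polyfun (\<lambda>p. f p - g p)"
  unfolding polyfun_def
proof (intro allI)
  fix p q
  obtain P Q where "\<forall>t. f (\<lambda>i. p i + t *\<^sub>R q i) = poly P t" "\<forall>t. g (\<lambda>i. p i + t *\<^sub>R q i) = poly Q t"
    using assms unfolding polyfun_def by blast
  then show "\<exists>P. \<forall>t. f (\<lambda>i. p i + t *\<^sub>R q i) - g (\<lambda>i. p i + t *\<^sub>R q i) = poly P t"
    by (intro exI[of _ "P - Q"]) simp
qed

text \<open>Along the line from \<open>p\<close> to \<open>q\<close> both functions become
  polynomials in one variable, nonzero at parameter 0 and 1 respectively, so their product has only
  finitely many roots.\<close>

lemma polyfun_common_nonzero:
  assumes "polyfun f" "polyfun g" "f p \<noteq> 0" "g q \<noteq> 0"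
  obtains r where "f r \<noteq> 0" "g r \<noteq> 0"
proof -
  obtain P where P: "f (\<lambda>i. p i + t *\<^sub>R (q i - p i)) = poly P t" for t
    using assms(1)[unfolded polyfun_def, rule_format, of p "\<lambda>i. q i - p i"] by auto
  obtain Q where Q: "g (\<lambda>i. p i + t *\<^sub>R (q i - p i)) = poly Q t" for t
    using assms(2)[unfolded polyfun_def, rule_format, of p "\<lambda>i. q i - p i"] by auto
  have "poly P 0 \<noteq> 0" "poly Q 1 \<noteq> 0"
    using P[of 0] Q[of 1] assms by auto
  then have "P * Q \<noteq> 0" by auto
  then have "finite {t. poly (P * Q) t = 0}" by (rule poly_roots_finite)
  then obtain t where "poly (P * Q) t \<noteq> 0"
    using ex_new_if_finite[OF infinite_UNIV_char_0] by blast
  then show thesis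
    using that[of "\<lambda>i. p i + t *\<^sub>R (q i - p i)"] P Q by auto
qed

text \<open>Stands in for "on a nonempty Zariski open set of placements"; being polynomial along lines is
  all that is needed for two such sets to meet.\<close>

definition generic :: "(('v \<Rightarrow> real^3) \<Rightarrow> bool) \<Rightarrow> bool" where
  "generic \<Phi> \<longleftrightarrow> (\<exists>f. polyfun f \<and> (\<exists>p. f p \<noteq> 0) \<and> (\<forall>p. f p \<noteq> 0 \<longrightarrow> \<Phi> p))"

lemma generic_conj:
  assumes "generic \<Phi>" "generic \<Psi>"
  shows "generic (\<lambda>p. \<Phi> p \<and> \<Psi> p)"
proof -
  obtain f p g q where *: "polyfun f" "f p \<noteq> 0" "\<And>p. f p \<noteq> 0 \<Longrightarrow> \<Phi> p"
    "polyfun g" "g q \<noteq> 0" "\<And>p. g p \<noteq> 0 \<Longrightarrow> \<Psi> p"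
    using assms unfolding generic_def by auto
  obtain r where "f r \<noteq> 0" "g r \<noteq> 0"
    using polyfun_common_nonzero[where f = f and g = g, OF *(1,4,2,5)] by blast
  then show ?thesis
    unfolding generic_def using * polyfun_mult[OF *(1,4)]
    by (intro exI[of _ "\<lambda>p. f p * g p"]) auto
qed

lemma generic_mono:
  assumes "generic \<Phi>" "\<And>p. \<Phi> p \<Longrightarrow> \<Psi> p"
  shows "generic \<Psi>"
proof -
  obtain f p where "polyfun f" "f p \<noteq> 0" "\<forall>p. f p \<noteq> 0 \<longrightarrow> \<Phi> p"
    using assms(1) unfolding generic_def by auto
  then show ?thesis
    unfolding generic_def using assms(2) by (intro exI[of _ f]) auto
qed

lemma generic_witness:
  assumes "generic \<Phi>"
  obtains p where "\<Phi> p"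
  using assms unfolding generic_def by auto

text \<open>Gaussian elimination with equations \<open>E\<close> and unknowns \<open>X\<close>, the
  pivots being chosen at \<open>p0\<close>. The same elimination works at every placement where no
  pivot vanishes, so \<open>f\<close> is the product of the pivots.\<close>

lemma elimination:
  fixes M :: "('v \<Rightarrow> real^3) \<Rightarrow> 'e \<Rightarrow> 'x \<Rightarrow> real"
  assumes "finite X" "finite E"
    and "\<And>e x. polyfun (\<lambda>p. M p e x)"
    and "\<And>m. (\<And>e. e \<in> E \<Longrightarrow> (\<Sum>x\<in>X. M p0 e x * m x) = 0) \<Longrightarrow> \<forall>x\<in>X. m x = 0"
  shows "card X \<le> card E"
    and "\<exists>f. polyfun f \<and> f p0 \<noteq> 0 \<and> (\<forall>p. f p \<noteq> 0 \<longrightarrow>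
      (\<forall>m. (\<forall>e\<in>E. (\<Sum>x\<in>X. M p e x * m x) = 0) \<longrightarrow> (\<forall>x\<in>X. m x = 0)))"
proof -
  have "card X \<le> card E \<and> (\<exists>f. polyfun f \<and> f p0 \<noteq> 0 \<and> (\<forall>p. f p \<noteq> 0 \<longrightarrow>
      (\<forall>m. (\<forall>e\<in>E. (\<Sum>x\<in>X. M p e x * m x) = 0) \<longrightarrow> (\<forall>x\<in>X. m x = 0))))"
    using assms
  proof (induction X arbitrary: E M rule: finite_induct)
    case empty
    show ?case using polyfun_const[of 1] by (auto intro!: exI[of _ "\<lambda>p. 1"])
  next
    case (insert x X)
    have "\<exists>e\<in>E. M p0 e x \<noteq> 0"
    proof (rule ccontr)
      assume "\<not> ?thesis"
      then have "\<forall>y\<in>insert x X. (if y = x then 1 else 0) = (0::real)"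
        using insert.hyps by (intro insert.prems(3)) (auto intro!: sum.neutral)
      then show False by auto
    qed
    then obtain e where e: "e \<in> E" "M p0 e x \<noteq> 0" by blast
    \<comment> \<open>Cross-multiplied instead of divided by the pivot, so that the entries stay
      polynomial along lines.\<close>
    define N where "N = (\<lambda>p e' y. M p e x * M p e' y - M p e' x * M p e y)"
    have sumN: "(\<Sum>y\<in>X. N p e' y * m y)
        = M p e x * (\<Sum>y\<in>X. M p e' y * m y) - M p e' x * (\<Sum>y\<in>X. M p e y * m y)" for p e' m
      unfolding N_def by (simp add: left_diff_distrib sum_subtractf sum_distrib_left mult.assoc)
    have "card X \<le> card (E - {e}) \<and> (\<exists>f. polyfun f \<and> f p0 \<noteq> 0 \<and> (\<forall>p. f p \<noteq> 0 \<longrightarrow>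
      (\<forall>m. (\<forall>e'\<in>E - {e}. (\<Sum>y\<in>X. N p e' y * m y) = 0) \<longrightarrow> (\<forall>y\<in>X. m y = 0))))"
    proof (rule insert.IH)
      show "finite (E - {e})" using insert.prems(1) by simp
      show "polyfun (\<lambda>p. N p e' y)" for e' y
        unfolding N_def by (intro polyfun_diff polyfun_mult insert.prems(2))
    next
      fix m assume m: "\<And>e'. e' \<in> E - {e} \<Longrightarrow> (\<Sum>y\<in>X. N p0 e' y * m y) = 0"
      \<comment> \<open>Back substitution: row \<open>e\<close> determines the value at
        \<open>x\<close>.\<close>
      define m' where "m' = (\<lambda>y. if y = x then - (\<Sum>y\<in>X. M p0 e y * m y) / M p0 e x else m y)"
      have s: "(\<Sum>y\<in>X. M p0 e' y * m' y) = (\<Sum>y\<in>X. M p0 e' y * m y)" for e'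
        using insert.hyps by (intro sum.cong) (auto simp: m'_def)
      have "\<forall>y\<in>insert x X. m' y = 0"
      proof (rule insert.prems(3))
        fix e' assume e': "e' \<in> E"
        show "(\<Sum>y\<in>insert x X. M p0 e' y * m' y) = 0"
        proof (cases "e' = e")
          case True
          then show ?thesis using insert.hyps e s by (simp add: m'_def)
        next
          case False
          then have "M p0 e x * (\<Sum>y\<in>X. M p0 e' y * m y)
            = M p0 e' x * (\<Sum>y\<in>X. M p0 e y * m y)"
            using m[of e'] e' sumN[of p0 e' m] by auto
          then show ?thesis using insert.hyps e s by (simp add: m'_def field_simps)
        qed
      qed
      then show "\<forall>y\<in>X. m y = 0"
        using insert.hyps by (metis insertCI m'_def)
    qed
    then obtain f where card: "card X \<le> card (E - {e})" and f: "polyfun f" "f p0 \<noteq> 0"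
      "\<And>p m. f p \<noteq> 0 \<Longrightarrow> (\<forall>e'\<in>E - {e}. (\<Sum>y\<in>X. N p e' y * m y) = 0) \<Longrightarrow> \<forall>y\<in>X. m y = 0"
      by (auto 4 4)
    have "\<forall>y\<in>insert x X. m y = 0"
      if "f p * M p e x \<noteq> 0" and m: "\<forall>e\<in>E. (\<Sum>y\<in>insert x X. M p e y * m y) = 0" for p m
    proof -
      have eq: "(\<Sum>y\<in>X. M p e' y * m y) = - M p e' x * m x" if "e' \<in> E" for e'
        using m[rule_format, OF that] insert.hyps by simp
      have "\<forall>y\<in>X. m y = 0"
        using that(1) eq e(1) by (intro f(3)) (auto simp: sumN)
      then show ?thesis
        using eq[OF e(1)] that(1) by simp
    qed
    moreover have "polyfun (\<lambda>p. f p * M p e x)"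
      by (intro polyfun_mult f insert.prems)
    moreover have "card (insert x X) \<le> card E"
      using card card_Suc_Diff1[OF insert.prems(1) e(1)] insert.hyps by simp
    moreover have "f p0 * M p0 e x \<noteq> 0" using e f(2) by simp
    ultimately show ?case by blast
  qed
  then show "card X \<le> card E"
    and "\<exists>f. polyfun f \<and> f p0 \<noteq> 0 \<and> (\<forall>p. f p \<noteq> 0 \<longrightarrow>
      (\<forall>m. (\<forall>e\<in>E. (\<Sum>x\<in>X. M p e x * m x) = 0) \<longrightarrow> (\<forall>x\<in>X. m x = 0)))"
    by blast+
qed

text \<open>Linear independence of the three vectors, in the dual form of a homogeneous system with
  trivial kernel that suits \<open>elimination\<close>.\<close>

definition nondeg :: "('v \<Rightarrow> real^3) \<Rightarrow> 'v \<Rightarrow> 'v \<Rightarrow> 'v \<Rightarrow> bool" where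
  "nondeg p a b c \<longleftrightarrow> (\<forall>x. p a \<bullet> x = 0 \<and> p b \<bullet> x = 0 \<and> p c \<bullet> x = 0 \<longrightarrow> x = 0)"

lemma nondegD:
  assumes "nondeg p a b c" "p a \<bullet> x = p a \<bullet> y" "p b \<bullet> x = p b \<bullet> y" "p c \<bullet> x = p c \<bullet> y"
  shows "x = y"
proof -
  have "x - y = 0"
    using assms(1)[unfolded nondeg_def, rule_format, of "x - y"] assms(2-4)
    by (simp add: inner_diff_right)
  then show ?thesis by simp
qed

lemma generic_nondeg:
  assumes "distinct [a, b, c]"
  shows "generic (\<lambda>p. nondeg p a b c)"
proof -
  define p0 :: "'a \<Rightarrow> real^3" where
    "p0 = (\<lambda>i. if i = a then axis 1 1 else if i = b then axis 2 1 else axis 3 1)"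
  have sum: "(\<Sum>k\<in>UNIV. p e $ k * m k) = p e \<bullet> (\<chi> k. m k)"
    for p :: "'a \<Rightarrow> real^3" and e m
    by (simp add: inner_vec_def)
  have "\<exists>f. polyfun f \<and> f p0 \<noteq> 0 \<and> (\<forall>p. f p \<noteq> 0 \<longrightarrow>
      (\<forall>m. (\<forall>e\<in>{a, b, c}. (\<Sum>k\<in>UNIV. p e $ k * m k) = 0) \<longrightarrow> (\<forall>k\<in>UNIV. m k = 0)))"
  proof (rule elimination(2))
    show "polyfun (\<lambda>p. p e $ k)" for e :: 'a and k :: 3
      by (rule polyfun_coord)
  next
    fix m :: "3 \<Rightarrow> real"
    assume *: "\<And>e. e \<in> {a, b, c} \<Longrightarrow> (\<Sum>k\<in>UNIV. p0 e $ k * m k) = 0"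
    have "m 1 = 0" "m 2 = 0" "m 3 = 0"
      using *[of a] *[of b] *[of c] assms by (auto simp: p0_def sum_3 axis_def)
    then show "\<forall>k\<in>UNIV. m k = 0"
      by (auto simp: forall_3)
  qed auto
  then obtain f where f: "polyfun f" "f p0 \<noteq> 0"
    "\<And>p m k. f p \<noteq> 0 \<Longrightarrow> (\<forall>e\<in>{a, b, c}. (\<Sum>k\<in>UNIV. p e $ k * m k) = 0) \<Longrightarrow> m k = 0"
    by auto
  have "nondeg p a b c" if "f p \<noteq> 0" for p
    unfolding nondeg_def
  proof (intro allI impI)
    fix x assume "p a \<bullet> x = 0 \<and> p b \<bullet> x = 0 \<and> p c \<bullet> x = 0"
    then have "x $ k = 0" for k
      using f(3)[OF that, of "\<lambda>k. x $ k"] by (simp add: sum)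
    then show "x = 0" by (simp add: vec_eq_iff)
  qed
  then show ?thesis
    using f unfolding generic_def by blast
qed

section \<open>Motions, gluing, triangles and pinning\<close>

text \<open>Motions for Kalai's hyperconnectivity matroid rather than for classical infinitesimal
  rigidity. The trivial motions are \<open>S \<circ> p\<close> with \<open>S\<close> symmetric, a space of dimension 6 again, but
  the conditions are homogeneous in each \<open>p i\<close>, which makes gluing and vertex splitting easier.\<close>

definition motion :: "'v set \<Rightarrow> 'v set set \<Rightarrow> ('v \<Rightarrow> real^3) \<Rightarrow> ('v \<Rightarrow> real^3) \<Rightarrow> bool" where
  "motion W E p m \<longleftrightarrow> (\<forall>i\<in>W. \<forall>j\<in>W. {i, j} \<in> E \<longrightarrow> p j \<bullet> m i = p i \<bullet> m j)"

text \<open>The symmetry identity already forces \<open>S\<close> to be linear, so \<open>S\<close>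
  ranges over the symmetric matrices.\<close>

definition rigid :: "'v set \<Rightarrow> 'v set set \<Rightarrow> ('v \<Rightarrow> real^3) \<Rightarrow> bool" where
  "rigid W E p \<longleftrightarrow> (\<forall>m. motion W E p m \<longrightarrow>
     (\<exists>S. (\<forall>x y. x \<bullet> S y = S x \<bullet> y) \<and> (\<forall>i\<in>W. m i = S (p i))))"

lemma rigidE:
  assumes "rigid W E p" "motion W E p m"
  obtains S where "\<And>x y. x \<bullet> S y = S x \<bullet> y" "\<And>i. i \<in> W \<Longrightarrow> m i = S (p i)"
  using assms(1)[unfolded rigid_def, rule_format, OF assms(2)] by auto

text \<open>Two symmetric maps that agree at three independent points coincide, because
  \<open>p a \<bullet> S x = S (p a) \<bullet> x\<close>.\<close>

lemma rigid_Un: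
  assumes "rigid W E p" "rigid W' E p" and "{a, b, c} \<subseteq> W \<inter> W'" "nondeg p a b c"
  shows "rigid (W \<union> W') E p"
  unfolding rigid_def
proof (intro allI impI)
  fix m assume "motion (W \<union> W') E p m"
  then have "motion W E p m" "motion W' E p m"
    unfolding motion_def by auto
  obtain S where S: "\<And>x y. x \<bullet> S y = S x \<bullet> y" "\<And>i. i \<in> W \<Longrightarrow> m i = S (p i)"
    using rigidE[OF assms(1) \<open>motion W E p m\<close>] by blast
  obtain S' where S': "\<And>x y. x \<bullet> S' y = S' x \<bullet> y" "\<And>i. i \<in> W' \<Longrightarrow> m i = S' (p i)"
    using rigidE[OF assms(2) \<open>motion W' E p m\<close>] by blast
  have "S x = S' x" for x
  proof (rule nondegD[OF assms(4)])
    have "S (p i) = S' (p i)" if "i \<in> {a, b, c}" for i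
    proof -
      have "i \<in> W" "i \<in> W'" using assms(3) that by blast+
      then show ?thesis using S(2) S'(2) by metis
    qed
    then show "p a \<bullet> S x = p a \<bullet> S' x" "p b \<bullet> S x = p b \<bullet> S' x" "p c \<bullet> S x = p c \<bullet> S' x"
      using S(1) S'(1) by auto
  qed
  then show "\<exists>S. (\<forall>x y. x \<bullet> S y = S x \<bullet> y) \<and> (\<forall>i\<in>W \<union> W'. m i = S (p i))"
    using S S' by (intro exI[of _ S]) auto
qed

lemma nondeg_dual_basis:
  assumes "nondeg p a b c"
  obtains q where "p a \<bullet> q = 1" "p b \<bullet> q = 0" "p c \<bullet> q = 0"
proof -
  define f :: "real^3 \<Rightarrow> real^3" where "f = (\<lambda>x. vector [p a \<bullet> x, p b \<bullet> x, p c \<bullet> x])"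
  have f: "f x $ 1 = p a \<bullet> x" "f x $ 2 = p b \<bullet> x" "f x $ 3 = p c \<bullet> x" for x
    unfolding f_def by (simp_all add: vector_3)
  have "linear f"
    by (rule linearI) (simp_all add: vec_eq_iff forall_3 f inner_add_right)
  moreover have "inj f"
    by (rule injI) (metis assms f nondegD)
  ultimately have "surj f"
    using linear_injective_imp_surjective by blast
  then obtain q where "f q = vector [1, 0, 0]" by (metis surjD)
  then show thesis
    using that[of q] f[of q] by (simp add: vector_3)
qed

text \<open>The three edge conditions say that the matrix with entries
  \<open>p i \<bullet> m j\<close> is symmetric. Read in the basis dual to the three points, this
  matrix is the required \<open>S\<close>.\<close>

lemma triangle_rigid:
  assumes "nondeg p a b c" "{{a, b}, {a, c}, {b, c}} \<subseteq> E"
  shows "rigid {a, b, c} E p"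
  unfolding rigid_def
proof (intro allI impI)
  fix m assume "motion {a, b, c} E p m"
  then have m: "p b \<bullet> m a = p a \<bullet> m b" "p c \<bullet> m a = p a \<bullet> m c" "p c \<bullet> m b = p b \<bullet> m c"
    using assms(2) unfolding motion_def by auto
  obtain x where x: "p a \<bullet> x = 1" "p b \<bullet> x = 0" "p c \<bullet> x = 0"
    using nondeg_dual_basis[OF assms(1)] .
  have "nondeg p b a c" "nondeg p c a b"
    using assms(1) unfolding nondeg_def by blast+
  then obtain y z where y: "p b \<bullet> y = 1" "p a \<bullet> y = 0" "p c \<bullet> y = 0"
    and z: "p c \<bullet> z = 1" "p a \<bullet> z = 0" "p b \<bullet> z = 0"
    using nondeg_dual_basis by metis
  define Q where "Q i = (if i = a then x else if i = b then y else z)" for i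
  define S where "S w = ((p a \<bullet> m a) * (x \<bullet> w) + (p b \<bullet> m a) * (y \<bullet> w) + (p c \<bullet> m a) * (z \<bullet> w)) *\<^sub>R x
    + ((p b \<bullet> m a) * (x \<bullet> w) + (p b \<bullet> m b) * (y \<bullet> w) + (p c \<bullet> m b) * (z \<bullet> w)) *\<^sub>R y
    + ((p c \<bullet> m a) * (x \<bullet> w) + (p c \<bullet> m b) * (y \<bullet> w) + (p c \<bullet> m c) * (z \<bullet> w)) *\<^sub>R z" for w
  have "S (p a) = m a" "S (p b) = m b" "S (p c) = m c"
    by (rule nondegD[OF assms(1)];
      simp add: S_def inner_add_right inner_commute[of _ "p _"] x y z m)+
  moreover have "v \<bullet> S w = S v \<bullet> w" for v w
    unfolding S_def by (simp add: inner_add_left inner_add_right inner_commute algebra_simps)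
  ultimately show "\<exists>S. (\<forall>x y. x \<bullet> S y = S x \<bullet> y) \<and> (\<forall>i\<in>{a, b, c}. m i = S (p i))"
    by (intro exI[of _ S]) auto
qed

text \<open>Subtracting the trivial motion given by \<open>triangle_rigid\<close> makes a motion
  vanish at \<open>a\<close>, \<open>b\<close>, \<open>c\<close>. Rigidity becomes the injectivity
  of a linear system, which \<open>elimination\<close> can treat.\<close>

lemma rigid_iff_pinned:
  assumes "nondeg p a b c" "{a, b, c} \<subseteq> W" "{{a, b}, {a, c}, {b, c}} \<subseteq> E"
  shows "rigid W E p \<longleftrightarrow>
    (\<forall>m. motion W E p m \<and> m a = 0 \<and> m b = 0 \<and> m c = 0 \<longrightarrow> (\<forall>i\<in>W. m i = 0))"
proof
  assume r: "rigid W E p"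
  show "\<forall>m. motion W E p m \<and> m a = 0 \<and> m b = 0 \<and> m c = 0 \<longrightarrow> (\<forall>i\<in>W. m i = 0)"
  proof (intro allI impI)
    fix m assume m: "motion W E p m \<and> m a = 0 \<and> m b = 0 \<and> m c = 0"
    obtain S where S: "\<And>x y. x \<bullet> S y = S x \<bullet> y" "\<And>i. i \<in> W \<Longrightarrow> m i = S (p i)"
      using rigidE[OF r conjunct1[OF m]] by blast
    have "S (p a) = 0" "S (p b) = 0" "S (p c) = 0"
      using m S(2) assms(2) by auto
    then have "S x = 0" for x
      by (intro nondegD[OF assms(1)]) (simp_all add: S(1))
    then show "\<forall>i\<in>W. m i = 0" using S by simp
  qed
next
  assume *: "\<forall>m. motion W E p m \<and> m a = 0 \<and> m b = 0 \<and> m c = 0 \<longrightarrow> (\<forall>i\<in>W. m i = 0)"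
  show "rigid W E p"
    unfolding rigid_def
  proof (intro allI impI)
    fix m assume m: "motion W E p m"
    then have "motion {a, b, c} E p m"
      using assms(2) unfolding motion_def by blast
    from rigidE[OF triangle_rigid[OF assms(1,3)] this]
    obtain S where S: "\<And>x y. x \<bullet> S y = S x \<bullet> y" "\<And>i. i \<in> {a, b, c} \<Longrightarrow> m i = S (p i)"
      by blast
    have "motion W E p (\<lambda>i. m i - S (p i))"
      unfolding motion_def
    proof (intro ballI impI)
      fix i j assume "i \<in> W" "j \<in> W" "{i, j} \<in> E"
      then have "p j \<bullet> m i = p i \<bullet> m j" using m unfolding motion_def by blast
      moreover have "p j \<bullet> S (p i) = p i \<bullet> S (p j)"
        using S(1)[of "p j" "p i"] by (simp add: inner_commute)
      ultimately show "p j \<bullet> (m i - S (p i)) = p i \<bullet> (m j - S (p j))"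
        by (simp add: inner_diff_right)
    qed
    then have "\<forall>i\<in>W. m i - S (p i) = 0"
      using *[rule_format, of "\<lambda>i. m i - S (p i)"] S(2) by auto
    then show "\<exists>S. (\<forall>x y. x \<bullet> S y = S x \<bullet> y) \<and> (\<forall>i\<in>W. m i = S (p i))"
      using S(1) by (intro exI[of _ S]) auto
  qed
qed

text \<open>No perturbation is needed: at the degenerate placement \<open>p u = p v\<close> the edge \<open>u v\<close> and the
  two common neighbours already force \<open>m u = m v\<close>.\<close>

lemma rigid_vertex_split:
  assumes r: "rigid W E' p" and uv: "u \<notin> W" "v \<in> W"
    and nd: "nondeg p v w w'" and w: "w \<in> W" "w' \<in> W"
    and nb: "{u, v} \<in> E" "{u, w} \<in> E" "{v, w} \<in> E" "{u, w'} \<in> E" "{v, w'} \<in> E"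
    and lift: "\<And>i j. i \<noteq> v \<Longrightarrow> j \<noteq> v \<Longrightarrow> i \<in> W \<Longrightarrow> j \<in> W \<Longrightarrow> {i, j} \<in> E' \<Longrightarrow> {i, j} \<in> E"
      "\<And>j. j \<noteq> v \<Longrightarrow> j \<in> W \<Longrightarrow> {v, j} \<in> E' \<Longrightarrow> {v, j} \<in> E \<or> {u, j} \<in> E"
  shows "rigid (insert u W) E (p(u := p v))"
  unfolding rigid_def
proof (intro allI impI)
  let ?p = "p(u := p v)"
  fix m assume m: "motion (insert u W) E ?p m"
  have p: "?p i = p i" if "i \<in> W" for i using that uv by auto
  have E: "?p j \<bullet> m i = ?p i \<bullet> m j" if "{i, j} \<in> E" "i \<in> insert u W" "j \<in> insert u W" for i j
    using m that unfolding motion_def by blast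
  have muv: "m u = m v"
  proof (rule nondegD[OF nd])
    show "p v \<bullet> m u = p v \<bullet> m v" using E[OF nb(1)] uv by auto
    show "p w \<bullet> m u = p w \<bullet> m v" using E[OF nb(2)] E[OF nb(3)] uv w p[OF w(1)] by auto
    show "p w' \<bullet> m u = p w' \<bullet> m v" using E[OF nb(4)] E[OF nb(5)] uv w p[OF w(2)] by auto
  qed
  have v: "p j \<bullet> m v = p v \<bullet> m j" if "j \<in> W" "{v, j} \<in> E'" for j
  proof (cases "j = v")
    case False
    then show ?thesis
      using lift(2)[OF False that] E[of v j] E[of u j] that uv muv p[OF that(1)] by auto
  qed simp
  have "motion W E' p m"
    unfolding motion_def
  proof (intro ballI impI)
    fix i j assume ij: "i \<in> W" "j \<in> W" "{i, j} \<in> E'"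
    show "p j \<bullet> m i = p i \<bullet> m j"
    proof (cases "i = v \<or> j = v")
      case True
      then show ?thesis using v[of i] v[of j] ij by (metis insert_commute)
    next
      case False
      then show ?thesis using E[of i j] lift(1)[of i j] ij p by auto
    qed
  qed
  from rigidE[OF r this]
  obtain S where "\<And>x y. x \<bullet> S y = S x \<bullet> y" "\<And>i. i \<in> W \<Longrightarrow> m i = S (p i)"
    by blast
  then show "\<exists>S. (\<forall>x y. x \<bullet> S y = S x \<bullet> y) \<and> (\<forall>i\<in>insert u W. m i = S (?p i))"
    using muv uv p by (intro exI[of _ S]) auto
qed

section \<open>From one rigid placement to generic rigidity and an edge count\<close>

definition edges_in :: "'v set \<Rightarrow> 'v set set \<Rightarrow> 'v set set" where
  "edges_in W E = {e \<in> E. e \<subseteq> W \<and> card e = 2}"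

text \<open>Pinning the triangle leaves \<open>3 * (card W - 3)\<close> unknown coordinates, and the
  three edges of the triangle no longer impose a condition. Injectivity of the remaining system at
  \<open>p\<close> gives both conclusions; the 6 is 9 pinned coordinates minus 3 dropped
  edges.\<close>

lemma rigid_pinned_generic_and_count:
  assumes W: "finite W" and abc: "distinct [a, b, c]" "{a, b, c} \<subseteq> W"
    and E: "{{a, b}, {a, c}, {b, c}} \<subseteq> E"
    and nd: "nondeg p a b c" and r: "rigid W E p"
  shows "generic (rigid W E)" and "3 * card W \<le> card (edges_in W E) + 6"
proof -
  define X where "X = (W - {a, b, c}) \<times> (UNIV :: 3 set)"
  define F where "F = edges_in W E - {{a, b}, {a, c}, {b, c}}"
  have "\<forall>e\<in>F. \<exists>s t. e = {s, t} \<and> s \<noteq> t"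
    unfolding F_def edges_in_def by (auto simp: card_2_iff)
  then obtain s t where st: "\<And>e. e \<in> F \<Longrightarrow> e = {s e, t e} \<and> s e \<noteq> t e"
    by metis
  \<comment> \<open>The row of \<open>e\<close> is the motion condition between its two ends;
    exchanging \<open>s e\<close> and \<open>t e\<close> only changes its sign.\<close>
  define M :: "('a \<Rightarrow> real^3) \<Rightarrow> 'a set \<Rightarrow> 'a \<times> 3 \<Rightarrow> real" where
    "M p e x = (if fst x = s e then p (t e) $ snd x
                else if fst x = t e then - p (s e) $ snd x else 0)" for p e x
  have fin_E: "finite (edges_in W E)"
    unfolding edges_in_def by (rule finite_subset[of _ "Pow W"]) (use W in auto)
  have tri: "{{a, b}, {a, c}, {b, c}} \<subseteq> edges_in W E"
    using E abc unfolding edges_in_def by auto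
  have card_tri: "card {{a, b}, {a, c}, {b, c}} = 3"
    using abc by (auto simp: doubleton_eq_iff card_insert_if)
  have fin: "finite X" "finite F"
    unfolding X_def F_def using W fin_E by auto
  have card: "card X = 3 * (card W - 3)" "card F = card (edges_in W E) - 3"
  proof -
    show "card X = 3 * (card W - 3)"
      unfolding X_def using abc W by (simp add: card_cartesian_product card_Diff_subset)
    show "card F = card (edges_in W E) - 3"
      unfolding F_def using tri fin_E card_tri by (simp add: card_Diff_subset)
  qed
  have poly: "polyfun (\<lambda>p. M p e x)" for e x
    using polyfun_coord polyfun_const[of 0] polyfun_diff[OF polyfun_const[of 0] polyfun_coord]
    unfolding M_def by (cases "fst x = s e"; cases "fst x = t e") simp_all
  have sum: "(\<Sum>x\<in>X. M p e x * m x) = p (t e) \<bullet> n (s e) - p (s e) \<bullet> n (t e)"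
    if "e \<in> F" "n = (\<lambda>i. if i \<in> W - {a, b, c} then \<chi> k. m (i, k) else 0)" for p e m n
  proof -
    let ?W = "W - {a, b, c}"
    have "(\<Sum>x\<in>X. M p e x * m x) = (\<Sum>i\<in>?W. \<Sum>k\<in>UNIV. M p e (i, k) * m (i, k))"
      unfolding X_def by (simp add: sum.cartesian_product)
    also have "\<dots> = (\<Sum>i\<in>?W. (if i = s e then p (t e) \<bullet> n i else 0)
        - (if i = t e then p (s e) \<bullet> n i else 0))"
      using st[OF that(1)] by (intro sum.cong)
        (auto simp: M_def that(2) inner_vec_def sum_negf)
    also have "\<dots> = p (t e) \<bullet> n (s e) - p (s e) \<bullet> n (t e)"
      using W by (simp add: sum_subtractf that(2))
    finally show ?thesis .
  qed
  have pin: "(\<forall>m. (\<forall>e\<in>F. (\<Sum>x\<in>X. M p e x * m x) = 0) \<longrightarrow> (\<forall>x\<in>X. m x = 0)) \<longleftrightarrow> rigid W E p"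
    if "nondeg p a b c" for p
    unfolding rigid_iff_pinned[OF that abc(2) E]
  proof (intro iffI allI impI ballI)
    fix m i
    assume *: "\<forall>m. (\<forall>e\<in>F. (\<Sum>x\<in>X. M p e x * m x) = 0) \<longrightarrow> (\<forall>x\<in>X. m x = 0)"
      and m: "motion W E p m \<and> m a = 0 \<and> m b = 0 \<and> m c = 0" and i: "i \<in> W"
    define n :: "'a \<Rightarrow> real^3" where "n = (\<lambda>i. if i \<in> W - {a, b, c} then \<chi> k. m i $ k else 0)"
    have n': "n = (\<lambda>i. if i \<in> W - {a, b, c} then \<chi> k::3. (\<lambda>x. m (fst x) $ snd x) (i, k) else 0)"
      by (auto simp: n_def fun_eq_iff)
    have n: "n j = m j" if "j \<in> W" for j
      using m that unfolding n_def by (auto simp: vec_eq_iff)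
    have "(\<Sum>x\<in>X. M p e x * m (fst x) $ snd x) = 0" if "e \<in> F" for e
    proof -
      have e: "{s e, t e} \<in> E" "s e \<in> W" "t e \<in> W"
        using that st[OF that] unfolding F_def edges_in_def by auto
      have "p (t e) \<bullet> m (s e) = p (s e) \<bullet> m (t e)"
        using m e unfolding motion_def by blast
      then show ?thesis
        using sum[OF that n', of p] n[OF e(2)] n[OF e(3)] by simp
    qed
    then have "\<forall>x\<in>X. m (fst x) $ snd x = 0"
      using *[rule_format, of "\<lambda>x. m (fst x) $ snd x"] by blast
    then show "m i = 0"
      using i m unfolding X_def by (cases "i \<in> {a, b, c}") (auto simp: vec_eq_iff)
  next
    fix m x
    assume *: "\<forall>m. motion W E p m \<and> m a = 0 \<and> m b = 0 \<and> m c = 0 \<longrightarrow> (\<forall>i\<in>W. m i = 0)"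
      and m: "\<forall>e\<in>F. (\<Sum>x\<in>X. M p e x * m x) = 0" and x: "x \<in> X"
    \<comment> \<open>The unknowns, extended by zero to the pinned vertices, so that the conditions
      on the triangle hold trivially.\<close>
    define n where "n = (\<lambda>i. if i \<in> W - {a, b, c} then \<chi> k. m (i, k) else 0)"
    have "motion W E p n"
      unfolding motion_def
    proof (intro ballI impI)
      fix i j assume ij: "i \<in> W" "j \<in> W" "{i, j} \<in> E"
      consider "i = j" | "i \<in> {a, b, c}" "j \<in> {a, b, c}" | "{i, j} \<in> F"
        using ij unfolding F_def edges_in_def
        by (cases "i = j"; cases "i \<in> {a, b, c} \<and> j \<in> {a, b, c}")
          (auto simp: doubleton_eq_iff card_insert_if)
      then show "p j \<bullet> n i = p i \<bullet> n j"
      proof cases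
        case 3
        then have "p (t {i, j}) \<bullet> n (s {i, j}) = p (s {i, j}) \<bullet> n (t {i, j})"
          using m sum[OF 3 n_def, of p] by simp
        then show ?thesis
          using st[OF 3] by (auto simp: doubleton_eq_iff)
      qed (auto simp: n_def)
    qed
    then have "n i = 0" if "i \<in> W" for i
      using *[rule_format, of n] that by (simp add: n_def)
    then have "n (fst x) $ snd x = 0" using x unfolding X_def by auto
    then show "m x = 0" using x unfolding X_def by (auto simp: n_def split: if_splits)
  qed
  have sys: "\<forall>m. (\<forall>e\<in>F. (\<Sum>x\<in>X. M p e x * m x) = 0) \<longrightarrow> (\<forall>x\<in>X. m x = 0)"
    using pin[OF nd] r by blast
  have "card X \<le> card F"
    by (rule elimination(1)[where M = M and ?p0.0 = p, OF fin poly]) (use sys in blast)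
  then have "3 * (card W - 3) \<le> card (edges_in W E) - 3"
    using card by simp
  moreover have "3 \<le> card (edges_in W E)"
    using card_mono[OF fin_E tri] card_tri by simp
  ultimately show "3 * card W \<le> card (edges_in W E) + 6"
    by linarith
  have "\<exists>f. polyfun f \<and> f p \<noteq> 0 \<and> (\<forall>p. f p \<noteq> 0 \<longrightarrow>
      (\<forall>m. (\<forall>e\<in>F. (\<Sum>x\<in>X. M p e x * m x) = 0) \<longrightarrow> (\<forall>x\<in>X. m x = 0)))"
    by (rule elimination(2)[where M = M and ?p0.0 = p, OF fin poly]) (use sys in blast)
  then have "generic (\<lambda>p. \<forall>m. (\<forall>e\<in>F. (\<Sum>x\<in>X. M p e x * m x) = 0) \<longrightarrow> (\<forall>x\<in>X. m x = 0))"
    unfolding generic_def by blast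
  \<comment> \<open>\<open>pin\<close> turns injectivity into rigidity only at placements where the
    triangle is nondegenerate, hence the second generic condition.\<close>
  from generic_conj[OF this generic_nondeg[OF abc(1)]] show "generic (rigid W E)"
    by (rule generic_mono) (use pin in auto)
qed

section \<open>Chains and boundaries\<close>

text \<open>Signs are booleans because the coefficient group has no unit to multiply by; the product
  of two signs is their equality.\<close>

definition signed :: "bool \<Rightarrow> 'g::ab_group_add \<Rightarrow> 'g" where
  "signed b a = (if b then a else - a)"

lemma signed_zero [simp]: "signed b 0 = 0"
  and signed_eq_0_iff [simp]: "signed b a = 0 \<longleftrightarrow> a = 0"
  and signed_signed [simp]: "signed b (signed b' a) = signed (b = b') a"
  and signed_add: "signed b (a + a') = signed b a + signed b a'"
  and signed_not: "b \<noteq> b' \<Longrightarrow> signed b a = - signed b' a"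
  by (auto simp: signed_def)

lemma signed_sum: "signed b (\<Sum>x\<in>X. f x) = (\<Sum>x\<in>X. signed b (f x))"
  by (auto simp: signed_def sum_negf)

text \<open>\<open>incidence x R\<close> is the sign of \<open>x\<close> in the face \<open>insert x R\<close>, for \<open>x \<notin> R\<close>, with \<open>True\<close> for plus:
  the position of \<open>x\<close>, counted from 1, is one more than the number of smaller vertices.\<close>

definition incidence :: "'v::linorder \<Rightarrow> 'v set \<Rightarrow> bool" where
  "incidence x R \<longleftrightarrow> odd (card {y \<in> R. y < x})"

text \<open>Exactly one of \<open>x < y\<close> and \<open>y < x\<close> holds, so inserting the
  other vertex flips exactly one of the two signs. All sign cancellations below rest on
  this.\<close>

lemma incidence_swap:
  assumes "finite R" "x \<noteq> y" "x \<notin> R" "y \<notin> R"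
  shows "(incidence x (insert y R) = incidence y R) \<noteq> (incidence y (insert x R) = incidence x R)"
proof -
  have *: "incidence a (insert b R) \<longleftrightarrow> (if b < a then \<not> incidence a R else incidence a R)"
    if "b \<notin> R" for a b
  proof -
    have "{z \<in> insert b R. z < a} = (if b < a then insert b {z \<in> R. z < a} else {z \<in> R. z < a})"
      by auto
    then show ?thesis using that assms(1) by (simp add: incidence_def)
  qed
  show ?thesis
    using *[of y x] *[of x y] assms by (cases "x < y") auto
qed

text \<open>The boundary evaluated at a face from its cofaces, rather than assembled from facets.
  Chains are plain functions here, and \<open>V\<close> is a finite ambient vertex set that keeps
  the sum finite.\<close>

definition bd :: "'v::linorder set \<Rightarrow> ('v set \<Rightarrow> 'g::ab_group_add) \<Rightarrow> 'v set \<Rightarrow> 'g" where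
  "bd V c R = (\<Sum>x\<in>V - R. signed (incidence x R) (c (insert x R)))"

lemma bd_add: "bd V (\<lambda>F. b F + c F) R = bd V b R + bd V c R"
  unfolding bd_def by (simp add: signed_add sum.distrib)

lemma bd_nonzeroE:
  assumes "bd V c R \<noteq> 0"
  obtains x where "x \<in> V - R" "c (insert x R) \<noteq> 0"
proof -
  have "\<exists>x\<in>V - R. c (insert x R) \<noteq> 0"
  proof (rule ccontr)
    assume "\<not> ?thesis"
    then have "bd V c R = 0" unfolding bd_def by (intro sum.neutral) auto
    then show False using assms by simp
  qed
  then show thesis using that by blast
qed

text \<open>The group may have 2-torsion, so a sum equal to its own negative need not vanish. The
  pairs are therefore cancelled one by one, by induction.\<close>

lemma sum_antisymmetric:
  fixes g :: "'a \<Rightarrow> 'a \<Rightarrow> 'g::ab_group_add"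
  assumes "finite D" "\<And>x y. x \<in> D \<Longrightarrow> y \<in> D \<Longrightarrow> x \<noteq> y \<Longrightarrow> g x y = - g y x"
  shows "(\<Sum>x\<in>D. \<Sum>y\<in>D - {x}. g x y) = 0"
  using assms
proof (induction D rule: finite_induct)
  case (insert a D)
  have "(\<Sum>x\<in>D. \<Sum>y\<in>insert a D - {x}. g x y) = (\<Sum>x\<in>D. g x a) + (\<Sum>x\<in>D. \<Sum>y\<in>D - {x}. g x y)"
    unfolding sum.distrib[symmetric]
  proof (rule sum.cong)
    fix x assume "x \<in> D"
    then have "insert a D - {x} = insert a (D - {x})" using insert.hyps by auto
    then show "(\<Sum>y\<in>insert a D - {x}. g x y) = g x a + (\<Sum>y\<in>D - {x}. g x y)"
      using insert.hyps by simp
  qed simp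
  also have "(\<Sum>x\<in>D. \<Sum>y\<in>D - {x}. g x y) = 0"
    by (rule insert.IH) (rule insert.prems; simp)
  also have "(\<Sum>x\<in>D. g x a) = - (\<Sum>y\<in>D. g a y)"
    unfolding sum_negf[symmetric]
  proof (rule sum.cong)
    fix x assume "x \<in> D"
    then show "g x a = - g a x" using insert.hyps by (intro insert.prems) auto
  qed simp
  finally show ?case using insert.hyps by simp
qed simp

lemma bd_bd:
  assumes "finite V" "R \<subseteq> V"
  shows "bd V (bd V c) R = 0"
proof -
  define g where "g x y = signed (incidence x R = incidence y (insert x R)) (c (insert y (insert x R)))" for x y
  have "bd V (bd V c) R = (\<Sum>x\<in>V - R. \<Sum>y\<in>(V - R) - {x}. g x y)"
    unfolding bd_def g_def signed_sum signed_signed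
    by (intro sum.cong) auto
  also have "\<dots> = 0"
  proof (rule sum_antisymmetric)
    fix x y assume "x \<in> V - R" "y \<in> V - R" "x \<noteq> y"
    moreover have "finite R" using assms finite_subset by blast
    ultimately have "(incidence x (insert y R) = incidence y R) \<noteq> (incidence y (insert x R) = incidence x R)"
      by (intro incidence_swap) auto
    then show "g x y = - g y x"
      unfolding g_def insert_commute[of y x R] by (intro signed_not) auto
  qed (use assms in simp)
  finally show ?thesis .
qed

text \<open>The push-forward of \<open>c\<close> under \<open>u \<mapsto> v\<close>; the sign is the one that makes this a chain map without
  reordering the vertices.\<close>

definition contract :: "'v::linorder \<Rightarrow> 'v \<Rightarrow> ('v set \<Rightarrow> 'g::ab_group_add) \<Rightarrow> 'v set \<Rightarrow> 'g" where
  "contract u v c H = (if u \<in> H then 0 else if v \<in> H then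
     c H + signed (incidence v (H - {v}) = incidence u (H - {v})) (c (insert u (H - {v}))) else c H)"

lemma bd_contract:
  assumes V: "finite V" and uv: "u \<in> V" "v \<in> V" "u \<noteq> v" and R: "R \<subseteq> V"
  shows "bd V (contract u v c) R = contract u v (bd V c) R"
proof -
  have finR: "finite R" using R V finite_subset by blast
  consider "u \<in> R" | "u \<notin> R" "v \<notin> R" | "u \<notin> R" "v \<in> R" by blast
  then show ?thesis
  proof cases
    case 1
    then show ?thesis by (simp add: bd_def contract_def)
  next
    case 2
    then have D: "V - R = insert u (insert v (V - R - {u, v}))" using uv by auto
    have sum: "(\<Sum>x\<in>V - R. f x) = f u + (f v + (\<Sum>x\<in>V - R - {u, v}. f x))" for f :: "'a \<Rightarrow> 'b"
      by (subst D) (use V uv in simp)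
    have "bd V (contract u v c) R = signed (incidence u R) (contract u v c (insert u R)) +
        (signed (incidence v R) (contract u v c (insert v R)) +
        (\<Sum>x\<in>V - R - {u, v}. signed (incidence x R) (contract u v c (insert x R))))"
      unfolding bd_def by (rule sum)
    also have "(\<Sum>x\<in>V - R - {u, v}. signed (incidence x R) (contract u v c (insert x R)))
      = (\<Sum>x\<in>V - R - {u, v}. signed (incidence x R) (c (insert x R)))"
      using 2 by (intro sum.cong) (auto simp: contract_def)
    also have "signed (incidence v R) (contract u v c (insert v R))
      = signed (incidence v R) (c (insert v R)) + signed (incidence u R) (c (insert u R))"
    proof -
      have "insert v R - {v} = R" using 2 by auto
      then show ?thesis
        using 2 uv by (cases "incidence v R") (simp_all add: contract_def signed_add)
    qed
    also have "signed (incidence u R) (contract u v c (insert u R)) +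
        (signed (incidence v R) (c (insert v R)) + signed (incidence u R) (c (insert u R)) +
        (\<Sum>x\<in>V - R - {u, v}. signed (incidence x R) (c (insert x R)))) = bd V c R"
      unfolding bd_def sum by (simp add: contract_def algebra_simps)
    also have "\<dots> = contract u v (bd V c) R"
      using 2 by (simp add: contract_def)
    finally show ?thesis .
  next
    case 3
    define K where "K = R - {v}"
    have K: "R = insert v K" "v \<notin> K" "u \<notin> K" "finite K" using 3 finR unfolding K_def by auto
    define s where "s = (incidence v K = incidence u K)"
    define D where "D = V - R - {u}"
    have D: "finite D" "u \<notin> D" "v \<notin> D" "V - insert v K = insert u D" "V - insert u K = insert v D"
      using V uv K unfolding D_def by auto
    have "bd V (contract u v c) R = (\<Sum>x\<in>D. signed (incidence x (insert v K)) (contract u v c (insert x (insert v K))))"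
      unfolding bd_def K(1) using D by (simp add: contract_def)
    also have "\<dots> = (\<Sum>x\<in>D. signed (incidence x (insert v K)) (c (insert x (insert v K)))
        + signed s (signed (incidence x (insert u K)) (c (insert x (insert u K)))))"
    proof (rule sum.cong)
      fix x assume x: "x \<in> D"
      then have xK: "x \<notin> K" "x \<noteq> u" "x \<noteq> v" unfolding D_def K(1) by auto
      have *: "insert x (insert v K) - {v} = insert x K" "u \<notin> insert x (insert v K)"
        using xK K uv by auto
      \<comment> \<open>Exchanging \<open>x\<close> with \<open>v\<close> and with \<open>u\<close>
        together moves the sign of \<open>contract\<close> from the coface down to
        \<open>R\<close>.\<close>
      have "(incidence x (insert v K) = incidence v K) \<noteq> (incidence v (insert x K) = incidence x K)"
        "(incidence x (insert u K) = incidence u K) \<noteq> (incidence u (insert x K) = incidence x K)"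
        using xK K by (intro incidence_swap; simp)+
      then have "(incidence x (insert v K) = (incidence v (insert x K) = incidence u (insert x K)))
        = (s = incidence x (insert u K))"
        unfolding s_def by auto
      then show "signed (incidence x (insert v K)) (contract u v c (insert x (insert v K)))
        = signed (incidence x (insert v K)) (c (insert x (insert v K)))
        + signed s (signed (incidence x (insert u K)) (c (insert x (insert u K))))"
        unfolding contract_def using * by (simp add: signed_add insert_commute)
    qed simp
    also have "\<dots> = (\<Sum>x\<in>D. signed (incidence x (insert v K)) (c (insert x (insert v K))))
        + signed s (\<Sum>x\<in>D. signed (incidence x (insert u K)) (c (insert x (insert u K))))"
      by (simp add: sum.distrib signed_sum)
    \<comment> \<open>The coface \<open>insert u (insert v K)\<close> collapses under the
      contraction. It occurs in both boundaries on the right, and its two terms have opposite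
      signs.\<close>
    also have "\<dots> = bd V c (insert v K) + signed s (bd V c (insert u K))"
    proof -
      have "(incidence u (insert v K) = incidence v K) \<noteq> (incidence v (insert u K) = incidence u K)"
        using K uv by (intro incidence_swap; simp)
      then have "incidence u (insert v K) \<noteq> (s = incidence v (insert u K))"
        unfolding s_def by auto
      from signed_not[OF this, of "c (insert u (insert v K))"] show ?thesis
        unfolding bd_def D(4,5) using D(1-3) by (simp add: signed_add insert_commute[of v u])
    qed
    also have "\<dots> = contract u v (bd V c) R"
      using K uv by (simp add: contract_def s_def)
    finally show ?thesis .
  qed
qed

section \<open>Contracting an edge of a minimal cycle\<close>

definition supp :: "('v set \<Rightarrow> 'g::ab_group_add) \<Rightarrow> 'v set set" where
  "supp c = {F. c F \<noteq> 0}"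

definition restrict_chain :: "('v set \<Rightarrow> 'g::ab_group_add) \<Rightarrow> 'v set set \<Rightarrow> 'v set \<Rightarrow> 'g" where
  "restrict_chain c X = (\<lambda>F. if F \<in> X then c F else 0)"

definition cycle :: "'v::linorder set \<Rightarrow> ('v set \<Rightarrow> 'g::ab_group_add) \<Rightarrow> bool" where
  "cycle V c \<longleftrightarrow> (\<forall>R\<subseteq>V. bd V c R = 0)"

text \<open>A subchain is determined by its support, so minimality is stated for sets of
  facets.\<close>

definition min_cycle :: "'v::linorder set \<Rightarrow> ('v set \<Rightarrow> 'g::ab_group_add) \<Rightarrow> bool" where
  "min_cycle V c \<longleftrightarrow> supp c \<noteq> {} \<and> cycle V c \<and>
     (\<forall>X\<subseteq>supp c. X \<noteq> {} \<longrightarrow> cycle V (restrict_chain c X) \<longrightarrow> X = supp c)"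

text \<open>The remnant of balancedness that survives contracting an edge inside
  \<open>A\<close>.\<close>

definition typed :: "'v set \<Rightarrow> 'v set \<Rightarrow> nat \<Rightarrow> 'v set set \<Rightarrow> bool" where
  "typed V A k \<F> \<longleftrightarrow> (\<forall>F\<in>\<F>. F \<subseteq> V \<and> card (F \<inter> A) = 3 \<and> card (F - A) = k)"

lemma bd_restrict_disjoint_Un:
  assumes "X \<inter> Y = {}"
  shows "bd V (restrict_chain c (X \<union> Y)) R
    = bd V (restrict_chain c X) R + bd V (restrict_chain c Y) R"
proof -
  have "restrict_chain c (X \<union> Y) = (\<lambda>F. restrict_chain c X F + restrict_chain c Y F)"
    using assms by (auto simp: restrict_chain_def fun_eq_iff)
  then show ?thesis by (simp add: bd_add)
qed

section \<open>Pieces of the contracted cycle and the boundaries of their lifts\<close>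

locale edge_contraction =
  fixes V A :: "'v::linorder set" and k :: nat
    and c :: "'v set \<Rightarrow> 'g::ab_group_add" and u v :: 'v
  assumes finV: "finite V" and min: "min_cycle V c" and tpd: "typed V A k (supp c)"
    and uv: "u \<noteq> v" "u \<in> A" "v \<in> A" and uvF: "\<exists>F\<in>supp c. u \<in> F \<and> v \<in> F"
begin

definition img :: "'v set \<Rightarrow> 'v set" where
  "img F = (if u \<in> F then insert v (F - {u}) else F)"

definition proper :: "'v set set" where
  "proper = {F \<in> supp c. \<not> (u \<in> F \<and> v \<in> F)}"

text \<open>\<open>T\<close> may be larger than the support of \<open>contract u v c\<close>: it also contains the facets at which
  two facets of \<open>c\<close> cancel.\<close>

definition T :: "'v set set" where
  "T = img ` proper"

definition lift :: "'v set set \<Rightarrow> 'v set set" where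
  "lift Q = {F \<in> proper. img F \<in> Q}"

text \<open>The defect that keeps the lift of a piece from being a cycle. For a cyclic piece its
  values at \<open>insert u K\<close> and \<open>insert v K\<close> determine each other up to
  sign.\<close>

definition \<beta> :: "'v set set \<Rightarrow> 'v set \<Rightarrow> 'g" where
  "\<beta> Q = bd V (restrict_chain c (lift Q))"

text \<open>A statement about a set of facets: a facet where the contracted chain vanishes is cyclic
  on its own, which a statement about chains could not express.\<close>

definition cyclic :: "'v set set \<Rightarrow> bool" where
  "cyclic Q \<longleftrightarrow> Q \<subseteq> T \<and> cycle V (restrict_chain (contract u v c) Q)"

lemma uvV: "u \<in> V" "v \<in> V"
  using tpd uvF unfolding typed_def by auto

lemma cycle_c: "cycle V c"
  using min unfolding min_cycle_def by blast

lemma suppD: "F \<in> supp c \<Longrightarrow> F \<subseteq> V" "F \<in> supp c \<Longrightarrow> card (F \<inter> A) = 3"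
  "F \<in> supp c \<Longrightarrow> card (F - A) = k"
  using tpd unfolding typed_def by auto

lemma lift_T: "lift T = proper"
  unfolding lift_def T_def by auto

text \<open>At \<open>H\<close> the contraction reads \<open>c\<close> only at facets with image
  \<open>H\<close>, and \<open>lift Q\<close> contains either all of these or none.\<close>

lemma restrict_contract:
  "restrict_chain (contract u v c) Q = contract u v (restrict_chain c (lift Q))"
proof
  fix H
  have "img H = H" if "u \<notin> H" using that by (simp add: img_def)
  moreover have "img (insert u (H - {v})) = H" if "u \<notin> H" "v \<in> H"
    using that by (auto simp: img_def)
  ultimately show "restrict_chain (contract u v c) Q H = contract u v (restrict_chain c (lift Q)) H"
    using uv by (auto simp: restrict_chain_def contract_def lift_def proper_def supp_def)
qed

lemma contract_\<beta>:
  assumes "cyclic Q" "R \<subseteq> V"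
  shows "contract u v (\<beta> Q) R = 0"
  unfolding \<beta>_def bd_contract[OF finV uvV uv(1) assms(2), symmetric] restrict_contract[symmetric]
  using assms unfolding cyclic_def cycle_def by blast

text \<open>If \<open>R\<close> contains both vertices, no facet of the lift contains
  \<open>R\<close>. If it contains neither, contraction does not change the value at
  \<open>R\<close>, and the contracted boundary is zero.\<close>

lemma \<beta>_eq_0:
  assumes "cyclic Q" "R \<subseteq> V" "u \<in> R \<longleftrightarrow> v \<in> R"
  shows "\<beta> Q R = 0"
proof (cases "u \<in> R")
  case True
  then show ?thesis
    using assms(3) unfolding \<beta>_def bd_def restrict_chain_def lift_def proper_def
    by (intro sum.neutral) auto
next
  case False
  then show ?thesis
    using contract_\<beta>[OF assms(1,2)] assms(3) by (simp add: contract_def)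
qed

lemma \<beta>_v_eq_0_iff:
  assumes "cyclic Q" "K \<subseteq> V" "u \<notin> K" "v \<notin> K"
  shows "\<beta> Q (insert v K) = 0 \<longleftrightarrow> \<beta> Q (insert u K) = 0"
proof -
  have "contract u v (\<beta> Q) (insert v K) = 0"
    using assms uvV by (intro contract_\<beta>) auto
  then show ?thesis
    using assms uv by (auto simp: contract_def add_eq_0_iff)
qed

lemma cyclic_T: "cyclic T"
proof -
  have "restrict_chain (contract u v c) T = contract u v c"
  proof
    fix H
    have "restrict_chain c proper F = c F" if "\<not> (u \<in> F \<and> v \<in> F)" for F
      using that by (auto simp: restrict_chain_def proper_def supp_def)
    then show "restrict_chain (contract u v c) T H = contract u v c H"
      unfolding restrict_contract lift_T using uv by (simp add: contract_def)
  qed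
  moreover have "cycle V (contract u v c)"
    unfolding cycle_def
  proof (intro allI impI)
    fix R assume R: "R \<subseteq> V"
    then have "insert u (R - {v}) \<subseteq> V" using uvV by blast
    with R have "bd V c R = 0" "bd V c (insert u (R - {v})) = 0"
      using cycle_c unfolding cycle_def by simp_all
    then show "bd V (contract u v c) R = 0"
      unfolding bd_contract[OF finV uvV uv(1) R] by (simp add: contract_def)
  qed
  ultimately show ?thesis unfolding cyclic_def by simp
qed

lemma lift_Un: "lift (P \<union> Q) = lift P \<union> lift Q"
  and lift_disjoint: "P \<inter> Q = {} \<Longrightarrow> lift P \<inter> lift Q = {}"
  unfolding lift_def by auto

lemma \<beta>_Un: "P \<inter> Q = {} \<Longrightarrow> \<beta> (P \<union> Q) R = \<beta> P R + \<beta> Q R"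
  unfolding \<beta>_def lift_Un by (intro bd_restrict_disjoint_Un lift_disjoint)

lemma cyclic_Diff:
  assumes "cyclic P" "cyclic Q" "Q \<subseteq> P"
  shows "cyclic (P - Q)"
proof -
  have "bd V (restrict_chain (contract u v c) (P - Q)) R = 0" if "R \<subseteq> V" for R
  proof -
    have "(P - Q) \<inter> Q = {}" "P - Q \<union> Q = P" using assms(3) by auto
    then show ?thesis
      using bd_restrict_disjoint_Un[of "P - Q" Q V "contract u v c" R] assms(1,2) that
      unfolding cyclic_def cycle_def by simp
  qed
  then show ?thesis
    using assms unfolding cyclic_def cycle_def by blast
qed

lemma cyclic_Un:
  assumes "cyclic P" "cyclic Q" "P \<inter> Q = {}"
  shows "cyclic (P \<union> Q)"
  using assms bd_restrict_disjoint_Un[OF assms(3), of V "contract u v c"]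
  unfolding cyclic_def cycle_def by auto

lemma lift_nonempty: "Q \<subseteq> T \<Longrightarrow> Q \<noteq> {} \<Longrightarrow> lift Q \<noteq> {}"
  unfolding lift_def T_def by blast

lemma minD:
  assumes "X \<subseteq> supp c" "X \<noteq> {}" "cycle V (restrict_chain c X)"
  shows "X = supp c"
  using min assms unfolding min_cycle_def by blast

text \<open>A face with exactly one of \<open>u\<close>, \<open>v\<close> has a single coface
  containing both, so the boundary there is one term.\<close>

lemma bd_restrict_through:
  assumes "\<And>F. F \<in> Y \<Longrightarrow> u \<in> F \<and> v \<in> F" "u \<notin> K" "v \<notin> K"
  shows "bd V (restrict_chain b Y) (insert u K)
      = signed (incidence v (insert u K)) (restrict_chain b Y (insert u (insert v K)))"
    and "bd V (restrict_chain b Y) (insert v K)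
      = signed (incidence u (insert v K)) (restrict_chain b Y (insert u (insert v K)))"
proof -
  have "bd V (restrict_chain b Y) (insert u K) = (\<Sum>x\<in>{v}.
      signed (incidence x (insert u K)) (restrict_chain b Y (insert x (insert u K))))"
    unfolding bd_def using finV uv uvV assms(2,3)
    by (intro sum.mono_neutral_right) (auto simp: restrict_chain_def dest!: assms(1))
  then show "bd V (restrict_chain b Y) (insert u K)
      = signed (incidence v (insert u K)) (restrict_chain b Y (insert u (insert v K)))"
    by (simp add: insert_commute)
  have "bd V (restrict_chain b Y) (insert v K) = (\<Sum>x\<in>{u}.
      signed (incidence x (insert v K)) (restrict_chain b Y (insert x (insert v K))))"
    unfolding bd_def using finV uv uvV assms(2,3)
    by (intro sum.mono_neutral_right) (auto simp: restrict_chain_def dest!: assms(1))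
  then show "bd V (restrict_chain b Y) (insert v K)
      = signed (incidence u (insert v K)) (restrict_chain b Y (insert u (insert v K)))"
    by simp
qed

text \<open>The lift of \<open>T\<close> together with the facets through \<open>u\<close> and
  \<open>v\<close> is all of \<open>c\<close>, a cycle. So the defect of \<open>T\<close> is
  cancelled by those facets, at each such face by a single one.\<close>

lemma \<beta>_T:
  assumes "u \<notin> K" "v \<notin> K" "K \<subseteq> V"
  shows "\<beta> T (insert u K) + signed (incidence v (insert u K)) (c (insert u (insert v K))) = 0"
    and "\<beta> T (insert v K) + signed (incidence u (insert v K)) (c (insert u (insert v K))) = 0"
proof -
  define Z where "Z = {F \<in> supp c. u \<in> F \<and> v \<in> F}"
  have Z: "\<And>F. F \<in> Z \<Longrightarrow> u \<in> F \<and> v \<in> F" unfolding Z_def by blast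
  have split: "\<beta> T R + bd V (restrict_chain c Z) R = 0" if "R \<subseteq> V" for R
  proof -
    have "\<beta> T R + bd V (restrict_chain c Z) R = bd V (restrict_chain c (proper \<union> Z)) R"
      unfolding \<beta>_def lift_T
      by (rule bd_restrict_disjoint_Un[symmetric]) (auto simp: proper_def Z_def)
    also have "\<dots> = bd V c R"
      unfolding bd_def
      by (intro sum.cong) (auto simp: restrict_chain_def proper_def supp_def Z_def)
    finally show ?thesis using cycle_c that unfolding cycle_def by simp
  qed
  have "restrict_chain c Z (insert u (insert v K)) = c (insert u (insert v K))"
    by (auto simp: Z_def restrict_chain_def supp_def)
  then show "\<beta> T (insert u K) + signed (incidence v (insert u K)) (c (insert u (insert v K))) = 0"
    "\<beta> T (insert v K) + signed (incidence u (insert v K)) (c (insert u (insert v K))) = 0"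
    using split[of "insert u K"] split[of "insert v K"] bd_restrict_through[OF Z assms(1,2), where b = c]
      assms(3) uvV by auto
qed

text \<open>If \<open>\<beta> Q\<close> and \<open>\<beta> (T - Q)\<close> had disjoint supports, then \<open>lift Q\<close> together with the
  facets of \<open>c\<close> through \<open>u\<close> and \<open>v\<close> that cancel \<open>\<beta> Q\<close> would carry a subcycle of \<open>c\<close>.\<close>

lemma \<beta>_common_support:
  assumes Q: "cyclic Q" "Q \<noteq> {}"
  shows "\<exists>K. K \<subseteq> V \<and> u \<notin> K \<and> v \<notin> K \<and> \<beta> Q (insert u K) \<noteq> 0 \<and>
    (Q \<noteq> T \<longrightarrow> \<beta> (T - Q) (insert u K) \<noteq> 0)"
proof (rule ccontr)
  assume no: "\<not> ?thesis"
  have sep: "Q \<noteq> T" "\<beta> (T - Q) (insert u K) = 0"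
    if "K \<subseteq> V" "u \<notin> K" "v \<notin> K" "\<beta> Q (insert u K) \<noteq> 0" for K
    using that no by blast+
  \<comment> \<open>The facets through \<open>u\<close> and \<open>v\<close> that should close up
    \<open>lift Q\<close>: such an \<open>F\<close> acts on the defect at \<open>F - {v}\<close> and
    \<open>F - {u}\<close>.\<close>
  define Y where "Y = {F \<in> supp c. u \<in> F \<and> v \<in> F \<and> \<beta> Q (F - {v}) \<noteq> 0}"
  have Y: "\<And>F. F \<in> Y \<Longrightarrow> u \<in> F \<and> v \<in> F" unfolding Y_def by blast
  have QT: "Q \<subseteq> T" using Q unfolding cyclic_def by blast
  have cyclic': "cyclic (T - Q)" by (rule cyclic_Diff[OF cyclic_T Q(1) QT])
  have Yc: "restrict_chain c Y (insert u (insert v K))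
      = (if \<beta> Q (insert u K) = 0 then 0 else c (insert u (insert v K)))" if "u \<notin> K" "v \<notin> K" for K
  proof -
    have "insert u (insert v K) - {v} = insert u K" using that uv by auto
    then show ?thesis unfolding Y_def restrict_chain_def supp_def by auto
  qed
  have \<beta>TQ: "\<beta> T R = \<beta> Q R + \<beta> (T - Q) R" for R
    using \<beta>_Un[of Q "T - Q" R] QT by (simp add: Un_absorb1)
  \<comment> \<open>Where \<open>\<beta> Q\<close> is nonzero, \<open>\<beta> (T - Q)\<close>
    vanishes by assumption, so \<open>\<beta> Q\<close> equals \<open>\<beta> T\<close> and
    \<open>\<beta>_T\<close> supplies the cancelling facet. Where it is zero, \<open>Y\<close> omits
    the facet.\<close>
  have u_case: "\<beta> Q (insert u K)
      + signed (incidence v (insert u K)) (restrict_chain c Y (insert u (insert v K))) = 0"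
    if "u \<notin> K" "v \<notin> K" "K \<subseteq> V" for K
    using \<beta>_T(1)[OF that] sep(2)[OF that(3,1,2)] \<beta>TQ[of "insert u K"] Yc[OF that(1,2)]
    by (cases "\<beta> Q (insert u K) = 0") auto
  have v_case: "\<beta> Q (insert v K)
      + signed (incidence u (insert v K)) (restrict_chain c Y (insert u (insert v K))) = 0"
    if "u \<notin> K" "v \<notin> K" "K \<subseteq> V" for K
    using \<beta>_T(2)[OF that] sep(2)[OF that(3,1,2)] \<beta>TQ[of "insert v K"] Yc[OF that(1,2)]
      \<beta>_v_eq_0_iff[OF Q(1) that(3,1,2)] \<beta>_v_eq_0_iff[OF cyclic' that(3,1,2)]
    by (cases "\<beta> Q (insert u K) = 0") auto
  \<comment> \<open>By \<open>u_case\<close> the coefficients on \<open>Y\<close> are, up to sign,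
    the values of \<open>\<beta> Q\<close> at faces through \<open>u\<close>. The boundary at a face
    through both vertices thus becomes a double boundary.\<close>
  have uv_case: "bd V (restrict_chain c Y) (insert u (insert v J)) = 0"
    if J: "u \<notin> J" "v \<notin> J" "J \<subseteq> V" for J
  proof -
    let ?D = "V - insert u (insert v J)"
    have finJ: "finite J" using J finV finite_subset by blast
    have "bd V (restrict_chain c Y) (insert u (insert v J))
      = (\<Sum>x\<in>?D. signed (incidence v (insert u J))
          (signed (incidence x (insert u J)) (\<beta> Q (insert x (insert u J)))))"
      unfolding bd_def
    proof (rule sum.cong)
      fix x assume x: "x \<in> ?D"
      let ?y = "restrict_chain c Y (insert u (insert v (insert x J)))"
      have "\<beta> Q (insert u (insert x J)) = - signed (incidence v (insert u (insert x J))) ?y"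
        using u_case[of "insert x J"] x J by (auto simp: add_eq_0_iff2)
      moreover have "(incidence x (insert v (insert u J)) = incidence v (insert u J))
          \<noteq> (incidence v (insert x (insert u J)) = incidence x (insert u J))"
        using x J finJ uv by (intro incidence_swap) auto
      ultimately show "signed (incidence x (insert u (insert v J))) (restrict_chain c Y (insert x (insert u (insert v J))))
        = signed (incidence v (insert u J))
          (signed (incidence x (insert u J)) (\<beta> Q (insert x (insert u J))))"
        by (auto simp: insert_commute signed_def)
    qed simp
    also have "\<dots> = signed (incidence v (insert u J)) (\<Sum>x\<in>V - insert u J.
          (signed (incidence x (insert u J)) (\<beta> Q (insert x (insert u J)))))"
    proof -
      have "\<beta> Q (insert v (insert u J)) = 0"
        using J uvV by (intro \<beta>_eq_0[OF Q(1)]) auto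
      then have "(\<Sum>x\<in>?D. signed (incidence x (insert u J)) (\<beta> Q (insert x (insert u J))))
        = (\<Sum>x\<in>V - insert u J. signed (incidence x (insert u J)) (\<beta> Q (insert x (insert u J))))"
        using finV by (intro sum.mono_neutral_left) auto
      then show ?thesis by (simp only: signed_sum[symmetric])
    qed
    also have "\<dots> = 0"
      using bd_bd[OF finV, of "insert u J" "restrict_chain c (lift Q)"] J uvV
      unfolding \<beta>_def bd_def[of V "bd V _"] by simp
    finally show ?thesis .
  qed
  have "cycle V (restrict_chain c (lift Q \<union> Y))"
    unfolding cycle_def
  proof (intro allI impI)
    fix R assume R: "R \<subseteq> V"
    have disj: "lift Q \<inter> Y = {}" unfolding lift_def proper_def Y_def by blast
    have split: "bd V (restrict_chain c (lift Q \<union> Y)) R = \<beta> Q R + bd V (restrict_chain c Y) R"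
      unfolding \<beta>_def by (rule bd_restrict_disjoint_Un[OF disj])
    define K where "K = R - {u, v}"
    have K: "u \<notin> K" "v \<notin> K" "K \<subseteq> V" using R unfolding K_def by auto
    consider "R = K" | "R = insert u K" | "R = insert v K" | "R = insert u (insert v K)"
      unfolding K_def by blast
    then show "bd V (restrict_chain c (lift Q \<union> Y)) R = 0"
    proof cases
      case 1
      have "bd V (restrict_chain c Y) R = 0"
        unfolding bd_def by (rule sum.neutral) (use K 1 uv Y in \<open>auto simp: restrict_chain_def\<close>)
      moreover have "\<beta> Q R = 0"
        by (rule \<beta>_eq_0[OF Q(1) R]) (use 1 K in auto)
      ultimately show ?thesis unfolding split by simp
    next
      case 2
      then show ?thesis
        unfolding split using u_case[OF K] bd_restrict_through(1)[OF Y K(1,2), where b = c] by simp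
    next
      case 3
      then show ?thesis
        unfolding split using v_case[OF K] bd_restrict_through(2)[OF Y K(1,2), where b = c] by simp
    next
      case 4
      then have "\<beta> Q R = 0"
        by (intro \<beta>_eq_0[OF Q(1) R]) auto
      then show ?thesis
        unfolding split using uv_case[OF K] 4 by simp
    qed
  qed
  moreover have "lift Q \<union> Y \<subseteq> supp c" unfolding lift_def proper_def Y_def by blast
  ultimately have all: "lift Q \<union> Y = supp c"
    using minD lift_nonempty[OF QT Q(2)] by blast
  \<comment> \<open>Only a nonzero value of \<open>\<beta> Q\<close> is at stake when
    \<open>Q = T\<close>. A facet through \<open>u\<close> and \<open>v\<close> cannot lie in
    \<open>lift Q\<close>, so it lies in \<open>Y\<close> and exhibits such a value.\<close>
  have "Q \<noteq> T"
  proof -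
    obtain F where F: "F \<in> supp c" "u \<in> F" "v \<in> F" using uvF by blast
    then have "F \<in> Y" using all unfolding lift_def proper_def by blast
    then have "\<beta> Q (insert u (F - {u, v})) \<noteq> 0"
      using F uv unfolding Y_def by (simp add: insert_Diff_if insert_absorb Diff_insert2[symmetric])
        (metis Diff_insert Diff_insert2 insert_Diff insert_Diff_if insert_iff singletonD)
    then show ?thesis
      using sep(1)[of "F - {u, v}"] suppD(1)[OF F(1)] by auto
  qed
  then have "lift (T - Q) \<noteq> {}" using QT by (intro lift_nonempty) auto
  moreover have "lift (T - Q) \<inter> (lift Q \<union> Y) = {}" "lift (T - Q) \<subseteq> supp c"
    unfolding lift_def proper_def Y_def by blast+
  ultimately show False using all by blast
qed

end

lemma bd_eq_0_other_term:
  assumes "finite V" "bd V c R = 0" "x \<in> V - R" "c (insert x R) \<noteq> 0"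
  obtains y where "y \<in> V - R" "y \<noteq> x" "c (insert y R) \<noteq> 0"
proof -
  have "bd V c R = signed (incidence x R) (c (insert x R))
    + (\<Sum>y\<in>V - R - {x}. signed (incidence y R) (c (insert y R)))"
    unfolding bd_def using assms(1,3) by (intro sum.remove) auto
  then have "(\<Sum>y\<in>V - R - {x}. signed (incidence y R) (c (insert y R))) \<noteq> 0"
    using assms(2,4) by auto
  then obtain y where "y \<in> V - R - {x}" "signed (incidence y R) (c (insert y R)) \<noteq> 0"
    by (rule sum.not_neutral_contains_not_neutral)
  then show thesis using that by auto
qed

lemma card_3_obtain:
  assumes "card S = 3"
  obtains a b c where "S = {a, b, c}" "distinct [a, b, c]"
proof -
  obtain a b c where "S = {a, b, c}" "a \<noteq> b" "b \<noteq> c" "a \<noteq> c"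
    using assms unfolding card_3_iff by blast
  then show thesis using that[of a b c] by simp
qed

section \<open>Rigidity of single pieces and their gluing\<close>

context edge_contraction
begin

lemma \<beta>_nonzeroE:
  assumes "\<beta> Q R \<noteq> 0"
  obtains x where "x \<in> V - R" "insert x R \<in> lift Q"
proof -
  obtain x where "x \<in> V - R" "restrict_chain c (lift Q) (insert x R) \<noteq> 0"
    using bd_nonzeroE assms unfolding \<beta>_def by blast
  then show thesis using that by (auto simp: restrict_chain_def split: if_splits)
qed

lemma liftD: "F \<in> lift Q \<Longrightarrow> F \<in> supp c" "F \<in> lift Q \<Longrightarrow> \<not> (u \<in> F \<and> v \<in> F)"
  "F \<in> lift Q \<Longrightarrow> img F \<in> Q"
  unfolding lift_def proper_def by auto

lemma \<beta>_nonzero_neighbours: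
  assumes "cyclic Q" "K \<subseteq> V" "u \<notin> K" "v \<notin> K" "\<beta> Q (insert u K) \<noteq> 0"
  shows "\<exists>F\<in>lift Q. insert u K \<subseteq> F" "\<exists>F\<in>lift Q. insert v K \<subseteq> F"
proof -
  obtain x where "insert x (insert u K) \<in> lift Q" using \<beta>_nonzeroE[OF assms(5)] by blast
  then show "\<exists>F\<in>lift Q. insert u K \<subseteq> F" by blast
  have "\<beta> Q (insert v K) \<noteq> 0" using assms(5) \<beta>_v_eq_0_iff[OF assms(1-4)] by simp
  from \<beta>_nonzeroE[OF this] obtain x where "insert x (insert v K) \<in> lift Q" by blast
  then show "\<exists>F\<in>lift Q. insert v K \<subseteq> F" by blast
qed

text \<open>The face \<open>insert u K\<close> lacks only one vertex of a facet, and the facet has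
  three in \<open>A\<close>. The vertex found here is the third one used for gluing.\<close>

lemma \<beta>_nonzero_meets_A:
  assumes "\<beta> Q (insert u K) \<noteq> 0"
  obtains w where "w \<in> K" "w \<in> A"
proof -
  obtain y where y: "insert y (insert u K) \<in> supp c"
    using \<beta>_nonzeroE[OF assms] liftD(1) by blast
  have "\<not> insert y (insert u K) \<inter> A \<subseteq> {y, u}"
  proof
    assume "insert y (insert u K) \<inter> A \<subseteq> {y, u}"
    then have "card (insert y (insert u K) \<inter> A) \<le> card {y, u}"
      by (intro card_mono) auto
    also have "\<dots> \<le> 2" by (simp add: card_insert_if)
    finally show False using suppD(2)[OF y] by simp
  qed
  then show thesis using that by blast
qed

text \<open>If \<open>K\<close> has two vertices in \<open>A\<close>, they serve. Otherwise
  \<open>K\<close> is one such \<open>w\<close> and a set \<open>J\<close> of \<open>k\<close>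
  vertices outside \<open>A\<close>. Since \<open>\<beta> Q\<close> is itself a boundary, the face
  \<open>insert u J\<close> has a second coface in its support. The new vertex differs from
  \<open>v\<close> by \<open>\<beta>_eq_0\<close>, and it lies in \<open>A\<close>, as a facet has
  only \<open>k\<close> vertices outside.\<close>

lemma common_neighbours:
  assumes "cyclic Q" "K \<subseteq> V" "u \<notin> K" "v \<notin> K" "\<beta> Q (insert u K) \<noteq> 0"
  obtains w w' where "w \<noteq> w'" "{w, w'} \<subseteq> A - {u, v}"
    "\<And>x. x \<in> {w, w'} \<Longrightarrow> \<exists>F\<in>lift Q. u \<in> F \<and> x \<in> F"
    "\<And>x. x \<in> {w, w'} \<Longrightarrow> \<exists>F\<in>lift Q. v \<in> F \<and> x \<in> F"
proof -
  obtain w where w: "w \<in> K" "w \<in> A" using \<beta>_nonzero_meets_A[OF assms(5)] .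
  have "\<exists>w' K'. w' \<noteq> w \<and> w' \<in> A \<and> w' \<in> K' \<and> K' \<subseteq> V \<and> u \<notin> K' \<and> v \<notin> K' \<and> \<beta> Q (insert u K') \<noteq> 0"
  proof (cases "K \<inter> A = {w}")
    case False
    then show ?thesis using w assms by blast
  next
    case True
    define J where "J = K - {w}"
    have J: "K = insert w J" "w \<notin> J" "J \<inter> A = {}" "u \<notin> J" "v \<notin> J" "J \<subseteq> V"
      using True w assms unfolding J_def by auto
    have finJ: "finite J" using J(6) finV finite_subset by blast
    obtain y where y: "insert y (insert u K) \<in> supp c"
      using \<beta>_nonzeroE[OF assms(5)] liftD(1) by blast
    have "y \<in> A"
    proof (rule ccontr)
      assume "y \<notin> A"
      then have "insert y (insert u K) \<inter> A = {u, w}" using True uv by auto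
      then show False using suppD(2)[OF y] by (simp add: card_insert_if split: if_splits)
    qed
    then have "insert y (insert u K) - A = J" using J w uv by auto
    then have cardJ: "card J = k" using suppD(3)[OF y] by simp
    have "bd V (\<beta> Q) (insert u J) = 0"
      unfolding \<beta>_def using J uvV by (intro bd_bd[OF finV]) auto
    moreover have "w \<in> V - insert u J" using w assms J by auto
    moreover have "\<beta> Q (insert w (insert u J)) \<noteq> 0" using assms(5) J(1) by (simp add: insert_commute)
    ultimately obtain x where x: "x \<in> V - insert u J" "x \<noteq> w" "\<beta> Q (insert x (insert u J)) \<noteq> 0"
      using bd_eq_0_other_term[OF finV] by blast
    have "x \<noteq> v"
      using \<beta>_eq_0[OF assms(1), of "insert v (insert u J)"] x(3) J uvV by auto
    moreover have "x \<in> A"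
    proof (rule ccontr)
      assume "x \<notin> A"
      obtain z where z: "insert z (insert x (insert u J)) \<in> supp c"
        using \<beta>_nonzeroE[OF x(3)] liftD(1) by blast
      have "insert x J \<subseteq> insert z (insert x (insert u J)) - A"
        using J \<open>x \<notin> A\<close> by auto
      then have "card (insert x J) \<le> card (insert z (insert x (insert u J)) - A)"
        using finJ by (intro card_mono) auto
      then show False using x(1) finJ cardJ suppD(3)[OF z] by simp
    qed
    ultimately show ?thesis
      using x J by (intro exI[of _ x] exI[of _ "insert x J"]) (auto simp: insert_commute)
  qed
  then obtain w' K' where w': "w' \<noteq> w" "w' \<in> A" "w' \<in> K'" "K' \<subseteq> V" "u \<notin> K'" "v \<notin> K'"
    "\<beta> Q (insert u K') \<noteq> 0" by blast
  show thesis
  proof (rule that[of w w'])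
    show "{w, w'} \<subseteq> A - {u, v}" using w w' assms by auto
    show "\<exists>F\<in>lift Q. u \<in> F \<and> x \<in> F" "\<exists>F\<in>lift Q. v \<in> F \<and> x \<in> F" if "x \<in> {w, w'}" for x
    proof -
      have "x \<in> K \<or> x \<in> K'" using that w w' by auto
      then show "\<exists>F\<in>lift Q. u \<in> F \<and> x \<in> F" "\<exists>F\<in>lift Q. v \<in> F \<and> x \<in> F"
        using \<beta>_nonzero_neighbours[OF assms] \<beta>_nonzero_neighbours[OF assms(1) w'(4-7)]
        by (meson insertI1 insertI2 subsetD)+
    qed
  qed (use w' in auto)
qed

lemma img_typed:
  assumes "F \<in> proper"
  shows "img F \<subseteq> V" "card (img F \<inter> A) = 3" "card (img F - A) = k"
proof -
  have F: "F \<in> supp c" "\<not> (u \<in> F \<and> v \<in> F)" using assms unfolding proper_def by auto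
  have finF: "finite F" using suppD(1)[OF F(1)] finV finite_subset by blast
  show "img F \<subseteq> V" using suppD(1)[OF F(1)] uvV unfolding img_def by auto
  have "img F - A = F - A" using uv unfolding img_def by auto
  then show "card (img F - A) = k" using suppD(3)[OF F(1)] by simp
  show "card (img F \<inter> A) = 3"
  proof (cases "u \<in> F")
    case True
    then have "img F \<inter> A = insert v (F \<inter> A - {u})" using uv unfolding img_def by auto
    moreover have "v \<notin> F \<inter> A - {u}" "u \<in> F \<inter> A" using F True uv by auto
    ultimately show ?thesis
      using suppD(2)[OF F(1)] finF by (simp add: card_Diff_singleton)
  qed (use suppD(2)[OF F(1)] in \<open>simp add: img_def\<close>)
qed

lemma u_notin_T: "u \<notin> \<Union>T"
  using uv unfolding T_def img_def by auto

lemma lift_Union: "Q \<subseteq> T \<Longrightarrow> \<Union>Q - {v} \<subseteq> \<Union>(lift Q)" "\<Union>(lift Q) - {u} \<subseteq> \<Union>Q"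
proof -
  have 1: "x \<in> \<Union>(lift Q)" if H: "Q \<subseteq> T" "H \<in> Q" "x \<in> H" "x \<noteq> v" for x H
  proof -
    obtain F where F: "F \<in> proper" "H = img F" using H(1,2) unfolding T_def by blast
    then have "F \<in> lift Q" "x \<in> F"
      using H unfolding lift_def img_def by (auto split: if_splits)
    then show ?thesis by blast
  qed
  have 2: "x \<in> \<Union>Q" if "F \<in> lift Q" "x \<in> F" "x \<noteq> u" for x F
  proof -
    have "img F \<in> Q" "x \<in> img F" using that unfolding lift_def img_def by auto
    then show ?thesis by blast
  qed
  show "Q \<subseteq> T \<Longrightarrow> \<Union>Q - {v} \<subseteq> \<Union>(lift Q)" "\<Union>(lift Q) - {u} \<subseteq> \<Union>Q"
    using 1 2 by blast+
qed

lemma finite_T: "finite T"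
  unfolding T_def proper_def
  by (rule finite_imageI, rule finite_subset[of _ "Pow V"]) (use suppD finV in auto)

text \<open>A minimal piece either is a single cancelled facet, which gives a triangle, or carries a minimal
  cycle with fewer vertices, to which the induction hypothesis applies.\<close>

lemma minimal_piece_rigid:
  assumes IH: "\<And>c' :: 'v set \<Rightarrow> 'g. card (\<Union>(supp c')) < card (\<Union>(supp c)) \<Longrightarrow>
      min_cycle V c' \<Longrightarrow> typed V A k (supp c') \<Longrightarrow>
      generic (rigid (A \<inter> \<Union>(supp c')) (generated_complex (supp c')))"
    and P: "cyclic P" "P \<noteq> {}" and minP: "\<And>Q. Q \<subseteq> P \<Longrightarrow> cyclic Q \<Longrightarrow> Q \<noteq> {} \<Longrightarrow> Q = P"
  shows "generic (rigid (A \<inter> \<Union>(lift P)) (generated_complex (supp c)))"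
proof -
  let ?c = "contract u v c"
  have PT: "P \<subseteq> T" using P(1) unfolding cyclic_def by blast
  have typP: "typed V A k P"
    using PT img_typed unfolding typed_def T_def by auto
  have fin: "finite (\<Union>(supp c))" by (rule finite_subset[OF _ finV]) (use suppD in auto)
  have g: "generic (rigid (A \<inter> \<Union>P) (generated_complex P))"
  proof (cases "\<exists>H\<in>P. ?c H = 0")
    case True
    then obtain H where H: "H \<in> P" "?c H = 0" by blast
    have "restrict_chain ?c {H} = (\<lambda>F. 0)" using H by (auto simp: restrict_chain_def)
    then have "cyclic {H}" using H PT unfolding cyclic_def cycle_def bd_def by auto
    then have PH: "P = {H}" using minP[of "{H}"] H by blast
    have "card (H \<inter> A) = 3" using typP H unfolding typed_def by blast
    then obtain x y z where xyz: "H \<inter> A = {x, y, z}" "distinct [x, y, z]"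
      by (rule card_3_obtain)
    have E: "{{x, y}, {x, z}, {y, z}} \<subseteq> generated_complex P"
      using xyz(1) unfolding generated_complex_def PH by auto
    have W: "A \<inter> \<Union>P = {x, y, z}" using xyz(1) PH by auto
    show ?thesis
      unfolding W by (rule generic_mono[OF generic_nondeg[OF xyz(2)]]) (rule triangle_rigid[OF _ E])
  next
    case False
    have suppP: "supp (restrict_chain ?c P) = P"
      using False unfolding supp_def restrict_chain_def by auto
    have "\<Union>P \<subset> \<Union>(supp c)"
    proof -
      have "\<Union>P \<subseteq> \<Union>(supp c)" using lift_Union(1)[OF PT] uvF liftD(1) by blast
      moreover have "u \<notin> \<Union>P" using u_notin_T PT by blast
      ultimately show ?thesis using uvF by blast
    qed
    then have less: "card (\<Union>P) < card (\<Union>(supp c))" by (rule psubset_card_mono[OF fin])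
    have "min_cycle V (restrict_chain ?c P)"
      unfolding min_cycle_def suppP
    proof (intro conjI allI impI)
      show "cycle V (restrict_chain ?c P)" using P unfolding cyclic_def by blast
      fix X assume X: "X \<subseteq> P" "X \<noteq> {}" "cycle V (restrict_chain (restrict_chain ?c P) X)"
      have "restrict_chain (restrict_chain ?c P) X = restrict_chain ?c X"
        using X(1) by (auto simp: restrict_chain_def fun_eq_iff)
      then have "cyclic X" using X PT unfolding cyclic_def by auto
      then show "X = P" using minP X by blast
    qed (rule P(2))
    then show ?thesis
      using IH[of "restrict_chain ?c P"] less typP unfolding suppP by blast
  qed
  \<comment> \<open>Minimality of \<open>c\<close> enters here: it makes the defect of the piece
    nonzero.\<close>
  obtain K where K: "K \<subseteq> V" "u \<notin> K" "v \<notin> K" "\<beta> P (insert u K) \<noteq> 0"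
    using \<beta>_common_support[OF P] by blast
  obtain w w' where w: "w \<noteq> w'" "{w, w'} \<subseteq> A - {u, v}"
    "\<And>x. x \<in> {w, w'} \<Longrightarrow> \<exists>F\<in>lift P. u \<in> F \<and> x \<in> F"
    "\<And>x. x \<in> {w, w'} \<Longrightarrow> \<exists>F\<in>lift P. v \<in> F \<and> x \<in> F"
    using common_neighbours[OF P(1) K] by metis
  let ?W = "A \<inter> \<Union>P"
  have uvl: "u \<in> \<Union>(lift P)" "v \<in> \<Union>(lift P)" using w(3)[of w] w(4)[of w] by auto
  have uP: "u \<notin> \<Union>P" using u_notin_T PT by blast
  have vP: "v \<in> \<Union>P" using lift_Union(2)[of P] uvl uv by blast
  have wP: "w \<in> ?W" "w' \<in> ?W" using lift_Union(2)[of P] w(3)[of w] w(3)[of w'] w(2) by auto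
  have W: "A \<inter> \<Union>(lift P) = insert u ?W"
    using lift_Union(1)[OF PT] lift_Union(2)[of P] uvl uv by blast
  obtain F where F: "F \<in> lift P" using lift_nonempty[OF PT P(2)] by blast
  obtain x y z where xyz: "F \<inter> A = {x, y, z}" "distinct [x, y, z]"
    using card_3_obtain[OF suppD(2)[OF liftD(1)[OF F]]] .
  \<comment> \<open>Moving \<open>u\<close> onto \<open>v\<close> places the triangle of
    \<open>F\<close> at \<open>\<pi> x\<close>, \<open>\<pi> y\<close>, \<open>\<pi> z\<close>.
    These are distinct because \<open>F\<close> does not contain both \<open>u\<close> and
    \<open>v\<close>, so the triangle can still be pinned at the degenerate placement.\<close>
  define \<pi> where "\<pi> i = (if i = u then v else i)" for i
  have "distinct [\<pi> x, \<pi> y, \<pi> z]"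
    using xyz liftD(2)[OF F] uv unfolding \<pi>_def by auto
  moreover have "distinct [v, w, w']" using w by auto
  ultimately obtain p where p: "rigid ?W (generated_complex P) p" "nondeg p v w w'"
    "nondeg p (\<pi> x) (\<pi> y) (\<pi> z)"
    using generic_witness[OF generic_conj[OF g generic_conj[OF generic_nondeg generic_nondeg]]]
    by blast
  let ?p = "p(u := p v)"
  have E: "{i, j} \<in> generated_complex (supp c)" if "F' \<in> lift P" "i \<in> F'" "j \<in> F'" for i j F'
    using that liftD(1) unfolding generated_complex_def by auto
  have r: "rigid (insert u ?W) (generated_complex (supp c)) ?p"
  proof (rule rigid_vertex_split[OF p(1) _ _ p(2) wP])
    show "u \<notin> ?W" "v \<in> ?W" using uP vP uv by auto
    show "{u, v} \<in> generated_complex (supp c)" using uvF unfolding generated_complex_def by auto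
    show "{u, w} \<in> generated_complex (supp c)" "{v, w} \<in> generated_complex (supp c)"
      "{u, w'} \<in> generated_complex (supp c)" "{v, w'} \<in> generated_complex (supp c)"
      using w(3)[of w] w(3)[of w'] w(4)[of w] w(4)[of w'] E by auto
  next
    fix i j assume ij: "i \<noteq> v" "j \<noteq> v" "i \<in> ?W" "j \<in> ?W" "{i, j} \<in> generated_complex P"
    obtain H where H: "H \<in> P" "i \<in> H" "j \<in> H" using ij unfolding generated_complex_def by auto
    then obtain F' where "F' \<in> lift P" "H = img F'" using PT unfolding lift_def T_def by blast
    then show "{i, j} \<in> generated_complex (supp c)"
      using H ij E[of F' i j] unfolding img_def by (auto split: if_splits)
  next
    fix j assume j: "j \<noteq> v" "j \<in> ?W" "{v, j} \<in> generated_complex P"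
    obtain H where H: "H \<in> P" "v \<in> H" "j \<in> H" using j unfolding generated_complex_def by auto
    then obtain F' where "F' \<in> lift P" "H = img F'" using PT unfolding lift_def T_def by blast
    then show "{v, j} \<in> generated_complex (supp c) \<or> {u, j} \<in> generated_complex (supp c)"
      using H j E[of F' v j] E[of F' u j] unfolding img_def by (auto split: if_splits)
  qed
  show ?thesis
    unfolding W
  proof (rule rigid_pinned_generic_and_count(1)[OF _ xyz(2) _ _ _ r])
    show "finite (insert u ?W)"
      unfolding W[symmetric] by (rule finite_subset[OF _ fin]) (use liftD(1) in auto)
    show "{x, y, z} \<subseteq> insert u ?W" unfolding W[symmetric] xyz(1)[symmetric] using F by auto
    have "x \<in> F" "y \<in> F" "z \<in> F" using xyz(1) by auto
    then show "{{x, y}, {x, z}, {y, z}} \<subseteq> generated_complex (supp c)" using E F by auto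
    have "?p i = p (\<pi> i)" for i unfolding \<pi>_def by simp
    then show "nondeg ?p x y z" using p(3) unfolding nondeg_def by simp
  qed
qed

text \<open>The defect is additive over disjoint pieces, so when \<open>P\<close> splits, a nonzero
  value at the given face survives in one of the two parts.\<close>

lemma minimal_piece_in:
  assumes "cyclic P" "P \<noteq> {}" "\<beta> P (insert u K) \<noteq> 0"
  shows "\<exists>Q\<subseteq>P. cyclic Q \<and> Q \<noteq> {} \<and> \<beta> Q (insert u K) \<noteq> 0 \<and>
    (\<forall>Q'\<subseteq>Q. cyclic Q' \<longrightarrow> Q' \<noteq> {} \<longrightarrow> Q' = Q)"
  using assms
proof (induction "card P" arbitrary: P rule: less_induct)
  case less
  show ?case
  proof (cases "\<forall>Q'\<subseteq>P. cyclic Q' \<longrightarrow> Q' \<noteq> {} \<longrightarrow> Q' = P")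
    case True
    then show ?thesis using less.prems by blast
  next
    case False
    then obtain Q where Q: "Q \<subseteq> P" "cyclic Q" "Q \<noteq> {}" "Q \<noteq> P" by blast
    have finP: "finite P" using less.prems(1) finite_T finite_subset unfolding cyclic_def by blast
    have "\<beta> P (insert u K) = \<beta> Q (insert u K) + \<beta> (P - Q) (insert u K)"
      using \<beta>_Un[of Q "P - Q" "insert u K"] Q(1) by (simp add: Un_absorb1)
    then have "\<beta> Q (insert u K) \<noteq> 0 \<or> \<beta> (P - Q) (insert u K) \<noteq> 0"
      using less.prems(3) by auto
    moreover have "cyclic (P - Q)" by (rule cyclic_Diff[OF less.prems(1) Q(2,1)])
    moreover have "card Q < card P" "card (P - Q) < card P"
      using Q finP by (auto intro!: psubset_card_mono)
    moreover have "P - Q \<noteq> {}" using Q by blast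
    ultimately have "\<exists>Q'\<subseteq>P. card Q' < card P \<and> cyclic Q' \<and> Q' \<noteq> {} \<and> \<beta> Q' (insert u K) \<noteq> 0"
      using Q by blast
    then obtain Q' where Q': "Q' \<subseteq> P" "card Q' < card P" "cyclic Q'" "Q' \<noteq> {}"
      "\<beta> Q' (insert u K) \<noteq> 0" by blast
    from less.hyps[OF Q'(2-5)] obtain Q'' where "Q'' \<subseteq> Q'" "cyclic Q''" "Q'' \<noteq> {}"
      "\<beta> Q'' (insert u K) \<noteq> 0" "\<forall>R\<subseteq>Q''. cyclic R \<longrightarrow> R \<noteq> {} \<longrightarrow> R = Q''" by blast
    then show ?thesis using Q'(1) by (intro exI[of _ Q'']) auto
  qed
qed

text \<open>Let \<open>Q\<close> be a maximal cyclic set whose lift is generically rigid. If facets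
  of \<open>T\<close> remain, \<open>\<beta>_common_support\<close> gives a face at which
  \<open>Q\<close> and the rest both have nonzero defect. A minimal piece of the rest with nonzero
  defect at that same face shares with \<open>Q\<close> the vertices \<open>u\<close>,
  \<open>v\<close> and one more of \<open>A\<close>, so it can be glued on, against
  maximality.\<close>

lemma contraction_rigid:
  assumes IH: "\<And>c' :: 'v set \<Rightarrow> 'g. card (\<Union>(supp c')) < card (\<Union>(supp c)) \<Longrightarrow>
      min_cycle V c' \<Longrightarrow> typed V A k (supp c') \<Longrightarrow>
      generic (rigid (A \<inter> \<Union>(supp c')) (generated_complex (supp c')))"
  shows "generic (rigid (A \<inter> \<Union>(supp c)) (generated_complex (supp c)))"
proof -
  define good where "good Q \<longleftrightarrow> cyclic Q \<and> Q \<noteq> {} \<and>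
    generic (rigid (A \<inter> \<Union>(lift Q)) (generated_complex (supp c)))" for Q
  have piece: "\<exists>Q\<subseteq>P. good Q \<and> \<beta> Q (insert u K) \<noteq> 0"
    if P: "cyclic P" "P \<noteq> {}" "\<beta> P (insert u K) \<noteq> 0" for P K
  proof -
    obtain Q where Q: "Q \<subseteq> P" "cyclic Q" "Q \<noteq> {}" "\<beta> Q (insert u K) \<noteq> 0"
      "\<And>Q'. Q' \<subseteq> Q \<Longrightarrow> cyclic Q' \<Longrightarrow> Q' \<noteq> {} \<Longrightarrow> Q' = Q"
      using minimal_piece_in[OF P] by auto
    then show ?thesis using minimal_piece_rigid[OF IH Q(2,3,5)] unfolding good_def by blast
  qed
  \<comment> \<open>The lift of \<open>T\<close> omits the facets through both \<open>u\<close> and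
    \<open>v\<close>. The cycle condition at \<open>F - {u}\<close> shows that their vertices other
    than \<open>u\<close> still occur in it.\<close>
  have other: "\<exists>F\<in>proper. x \<in> F" if F: "F \<in> supp c" "u \<in> F" "v \<in> F" and x: "x \<in> F" "x \<noteq> u" for F x
  proof -
    have "bd V c (F - {u}) = 0" using cycle_c suppD(1)[OF F(1)] unfolding cycle_def by (simp add: subset_iff)
    moreover have "insert u (F - {u}) = F" using F by auto
    ultimately obtain y where "y \<in> V - (F - {u})" "y \<noteq> u" "c (insert y (F - {u})) \<noteq> 0"
      using bd_eq_0_other_term[OF finV, of c "F - {u}" u] F uvV unfolding supp_def by auto
    then show ?thesis
      using x uv unfolding proper_def supp_def by (intro bexI[of _ "insert y (F - {u})"]) auto
  qed
  have T: "T \<noteq> {}"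
    using uvF other[of _ v] uv unfolding T_def by blast
  obtain K where K: "K \<subseteq> V" "u \<notin> K" "v \<notin> K" "\<beta> T (insert u K) \<noteq> 0"
    using \<beta>_common_support[OF cyclic_T T] by blast
  have fin: "finite {Q. good Q}"
    by (rule finite_subset[of _ "Pow T"]) (auto simp: good_def cyclic_def finite_T)
  have "{Q. good Q} \<noteq> {}" using piece[OF cyclic_T T K(4)] by blast
  then obtain Q where Q: "good Q" and maxQ: "\<And>Q'. good Q' \<Longrightarrow> Q \<subseteq> Q' \<Longrightarrow> Q' = Q"
    using finite_has_maximal[OF fin] by (metis mem_Collect_eq)
  have "Q = T"
  proof (rule ccontr)
    assume QT: "Q \<noteq> T"
    have Q': "cyclic Q" "Q \<noteq> {}" "Q \<subseteq> T" using Q unfolding good_def cyclic_def by auto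
    obtain L where L: "L \<subseteq> V" "u \<notin> L" "v \<notin> L" "\<beta> Q (insert u L) \<noteq> 0" "\<beta> (T - Q) (insert u L) \<noteq> 0"
      using \<beta>_common_support[OF Q'(1,2)] QT by blast
    have "cyclic (T - Q)" "T - Q \<noteq> {}" using cyclic_Diff[OF cyclic_T Q'(1,3)] QT Q'(3) by auto
    from piece[OF this L(5)] obtain P where P: "P \<subseteq> T - Q" "good P" "\<beta> P (insert u L) \<noteq> 0" by blast
    then have P': "cyclic P" "P \<noteq> {}" "Q \<inter> P = {}" unfolding good_def by auto
    obtain w where w: "w \<in> L" "w \<in> A" using \<beta>_nonzero_meets_A[OF L(4)] .
    have common: "{u, v, w} \<subseteq> (A \<inter> \<Union>(lift Q)) \<inter> (A \<inter> \<Union>(lift P))"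
      using \<beta>_nonzero_neighbours[OF Q'(1) L(1-4)] \<beta>_nonzero_neighbours[OF P'(1) L(1-3) P(3)] w uv
      by auto
    have d: "distinct [u, v, w]" using uv w L by auto
    have "generic (rigid (A \<inter> \<Union>(lift Q)) (generated_complex (supp c)))"
      "generic (rigid (A \<inter> \<Union>(lift P)) (generated_complex (supp c)))"
      using Q P(2) unfolding good_def by simp_all
    from generic_conj[OF this(1) generic_conj[OF this(2) generic_nondeg[OF d]]]
    have "generic (rigid (A \<inter> \<Union>(lift Q) \<union> A \<inter> \<Union>(lift P)) (generated_complex (supp c)))"
      by (rule generic_mono) (rule rigid_Un[OF _ _ common], simp_all)
    then have "good (Q \<union> P)"
      unfolding good_def lift_Un using cyclic_Un[OF Q'(1) P'(1,3)] Q'(2)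
      by (simp add: Int_Un_distrib)
    then show False using maxQ[of "Q \<union> P"] P' by blast
  qed
  moreover have "A \<inter> \<Union>(lift T) = A \<inter> \<Union>(supp c)"
  proof -
    have "u \<in> \<Union>(lift T)"
      using \<beta>_nonzero_neighbours(1)[OF cyclic_T K] by auto
    then have "\<Union>(supp c) \<subseteq> \<Union>(lift T)"
      using other unfolding lift_T proper_def by blast
    then show ?thesis using liftD(1) by blast
  qed
  ultimately show ?thesis using Q unfolding good_def by simp
qed

end

text \<open>The induction has no base case: every facet offers an edge inside \<open>A\<close> to
  contract, and in a cycle with the fewest vertices all minimal pieces are single cancelled
  facets.\<close>

theorem min_cycle_generic_rigid:
  fixes c :: "'v::linorder set \<Rightarrow> 'g::ab_group_add"
  assumes "finite V" "min_cycle V c" "typed V A k (supp c)"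
  shows "generic (rigid (A \<inter> \<Union>(supp c)) (generated_complex (supp c)))"
  using assms(2,3)
proof (induction "card (\<Union>(supp c))" arbitrary: c rule: less_induct)
  case less
  obtain F where F: "F \<in> supp c" using less.prems(1) unfolding min_cycle_def by blast
  then have "card (F \<inter> A) = 3" using less.prems(2) unfolding typed_def by blast
  then obtain u v w where uv: "F \<inter> A = {u, v, w}" "distinct [u, v, w]" by (rule card_3_obtain)
  have "edge_contraction V A k c u v"
    by unfold_locales (use assms(1) less.prems F uv in auto)
  from edge_contraction.contraction_rigid[OF this less.hyps] show ?case by blast
qed

section \<open>Counting edges of rank-selected subcomplexes\<close>

lemma card_less_nth_sorted_list_of_set:
  fixes F :: "'v::linorder set"
  assumes "finite F" "i < card F"
  shows "card {y \<in> F. y < sorted_list_of_set F ! i} = i"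
proof -
  let ?xs = "sorted_list_of_set F"
  have len: "length ?xs = card F" and dist: "distinct ?xs" and set: "set ?xs = F"
    using assms(1) by auto
  have sorted: "sorted_wrt (<) ?xs" by simp
  have "{y \<in> F. y < ?xs ! i} = (\<lambda>j. ?xs ! j) ` {..<i}"
  proof (intro set_eqI iffI)
    fix y assume "y \<in> {y \<in> F. y < ?xs ! i}"
    then have "y \<in> set ?xs" "y < ?xs ! i" using set by auto
    then obtain j where j: "j < length ?xs" "y = ?xs ! j" by (metis in_set_conv_nth)
    have "j < i"
    proof (rule ccontr)
      assume "\<not> j < i"
      then have "?xs ! i \<le> ?xs ! j" using sorted_nth_mono[of ?xs i j] j by simp
      then show False using j \<open>y < ?xs ! i\<close> by simp
    qed
    then show "y \<in> (\<lambda>j. ?xs ! j) ` {..<i}" using j by blast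
  next
    fix y assume "y \<in> (\<lambda>j. ?xs ! j) ` {..<i}"
    then obtain j where j: "j < i" "y = ?xs ! j" by auto
    then show "y \<in> {y \<in> F. y < ?xs ! i}"
      using sorted_wrt_nth_less[OF sorted j(1)] nth_mem[of j ?xs] assms len set by auto
  qed
  moreover have "inj_on (\<lambda>j. ?xs ! j) {..<i}"
    using assms(2) len dist by (auto intro!: inj_onI simp: nth_eq_iff_index_eq)
  ultimately show ?thesis by (simp add: card_image)
qed

text \<open>Both sides collect the pairs of a facet and a vertex whose removal leaves
  \<open>R\<close>, once by facets and once by vertices.\<close>

lemma lookup_boundary:
  fixes c :: "'v::linorder set \<Rightarrow>\<^sub>0 'g::ab_group_add"
  assumes V: "finite V" "Poly_Mapping.keys c \<subseteq> Pow V"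
  shows "Poly_Mapping.lookup (boundary c) R = bd V (Poly_Mapping.lookup c) R"
proof -
  let ?c = "Poly_Mapping.lookup c" and ?K = "Poly_Mapping.keys c"
  have inner: "(\<Sum>j=1..card F. Poly_Mapping.lookup (Poly_Mapping.single (F - {sorted_list_of_set F ! (j - 1)})
      (if even j then ?c F else - ?c F)) R)
    = (\<Sum>x\<in>V. if x \<notin> R \<and> F = insert x R then signed (incidence x R) (?c F) else 0)"
    if F: "F \<in> ?K" for F
  proof -
    let ?xs = "sorted_list_of_set F"
    have FV: "F \<subseteq> V" using V F by blast
    have finF: "finite F" by (rule finite_subset[OF FV V(1)])
    have bij: "bij_betw (\<lambda>j. ?xs ! (j - 1)) {1..card F} F"
    proof -
      have "bij_betw (\<lambda>i. ?xs ! i) {..<length ?xs} (set ?xs)"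
        by (rule bij_betw_nth) auto
      moreover have "bij_betw (\<lambda>j. j - 1) {1..card F} {..<card F}"
        by (rule bij_betw_byWitness[of _ Suc]) auto
      ultimately show ?thesis
        using finF bij_betw_trans[of "\<lambda>j. j - 1" "{1..card F}" "{..<card F}" "\<lambda>i. ?xs ! i" F]
        by (simp add: comp_def)
    qed
    have single: "Poly_Mapping.lookup (Poly_Mapping.single (F - {?xs ! (j - 1)})
        (if even j then ?c F else - ?c F)) R
      = (if F - {?xs ! (j - 1)} = R then signed (incidence (?xs ! (j - 1)) R) (?c F) else 0)"
      if j: "j \<in> {1..card F}" for j
    proof (cases "F - {?xs ! (j - 1)} = R")
      case True
      have "{y \<in> R. y < ?xs ! (j - 1)} = {y \<in> F. y < ?xs ! (j - 1)}" using True by auto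
      moreover have "j - 1 < card F" using j by auto
      ultimately have "card {y \<in> R. y < ?xs ! (j - 1)} = j - 1"
        by (simp only: card_less_nth_sorted_list_of_set[OF finF])
      \<comment> \<open>The \<open>j\<close>-th vertex, counted from 1, has \<open>j - 1\<close>
        smaller ones in \<open>R\<close>; so the plus sign at even \<open>j\<close> corresponds to
        an odd count.\<close>
      then have "incidence (?xs ! (j - 1)) R \<longleftrightarrow> odd (j - 1)"
        unfolding incidence_def by simp
      also have "\<dots> \<longleftrightarrow> even j" using j by (cases j) auto
      finally show ?thesis using True by (simp add: lookup_single signed_def)
    qed (simp add: lookup_single)
    have "(\<Sum>j=1..card F. Poly_Mapping.lookup (Poly_Mapping.single (F - {?xs ! (j - 1)})
        (if even j then ?c F else - ?c F)) R)
      = (\<Sum>j=1..card F. if F - {?xs ! (j - 1)} = R then signed (incidence (?xs ! (j - 1)) R) (?c F) else 0)"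
      by (rule sum.cong[OF refl single])
    also have "\<dots> = (\<Sum>x\<in>F. if F - {x} = R then signed (incidence x R) (?c F) else 0)"
      by (rule sum.reindex_bij_betw[OF bij])
    also have "\<dots> = (\<Sum>x\<in>F. if x \<notin> R \<and> F = insert x R then signed (incidence x R) (?c F) else 0)"
      by (intro sum.cong if_cong) auto
    also have "\<dots> = (\<Sum>x\<in>V. if x \<notin> R \<and> F = insert x R then signed (incidence x R) (?c F) else 0)"
      using V(1) FV by (intro sum.mono_neutral_left) auto
    finally show ?thesis .
  qed
  have "Poly_Mapping.lookup (boundary c) R
    = (\<Sum>F\<in>?K. \<Sum>x\<in>V. if x \<notin> R \<and> F = insert x R then signed (incidence x R) (?c F) else 0)"
    unfolding boundary_def lookup_sum by (rule sum.cong[OF refl inner])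
  also have "\<dots> = (\<Sum>x\<in>V. \<Sum>F\<in>?K. if x \<notin> R \<and> F = insert x R then signed (incidence x R) (?c F) else 0)"
    by (rule sum.swap)
  also have "\<dots> = (\<Sum>x\<in>V. if x \<notin> R then signed (incidence x R) (?c (insert x R)) else 0)"
  proof (rule sum.cong[OF refl])
    fix x assume "x \<in> V"
    have "(\<Sum>F\<in>?K. if F = insert x R then signed (incidence x R) (?c F) else 0)
      = (if insert x R \<in> ?K then signed (incidence x R) (?c (insert x R)) else 0)"
      by simp
    then show "(\<Sum>F\<in>?K. if x \<notin> R \<and> F = insert x R then signed (incidence x R) (?c F) else 0)
      = (if x \<notin> R then signed (incidence x R) (?c (insert x R)) else 0)"
      by (cases "x \<in> R") (auto simp: in_keys_iff)
  qed
  also have "\<dots> = bd V ?c R"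
    unfolding bd_def using V by (intro sum.mono_neutral_cong_right) auto
  finally show ?thesis .
qed

lemma supp_lookup: "supp (Poly_Mapping.lookup c) = Poly_Mapping.keys c"
  unfolding supp_def by (auto simp: in_keys_iff)

lemma boundary_eq_0_iff_cycle:
  assumes "finite V" "Poly_Mapping.keys c \<subseteq> Pow V"
  shows "boundary c = 0 \<longleftrightarrow> cycle V (Poly_Mapping.lookup c)"
proof
  assume "boundary c = 0"
  then show "cycle V (Poly_Mapping.lookup c)"
    unfolding cycle_def by (simp add: lookup_boundary[OF assms, symmetric])
next
  assume *: "cycle V (Poly_Mapping.lookup c)"
  show "boundary c = 0"
  proof (rule poly_mapping_eqI)
    fix R
    have "bd V (Poly_Mapping.lookup c) R = 0"
    proof (cases "R \<subseteq> V")
      case False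
      then have "insert x R \<notin> Poly_Mapping.keys c" for x using assms(2) by blast
      then show ?thesis unfolding bd_def by (simp add: in_keys_iff)
    qed (use * in \<open>simp add: cycle_def\<close>)
    then show "Poly_Mapping.lookup (boundary c) R = Poly_Mapping.lookup 0 R"
      using lookup_boundary[OF assms] by simp
  qed
qed

lemma minimal_cycle_imp_min_cycle:
  assumes m: "minimal_cycle i c" "c \<noteq> 0" and V: "finite V" "Poly_Mapping.keys c \<subseteq> Pow V"
  shows "min_cycle V (Poly_Mapping.lookup c)"
  unfolding min_cycle_def supp_lookup
proof (intro conjI allI impI)
  show "Poly_Mapping.keys c \<noteq> {}" using m(2) by simp
  show "cycle V (Poly_Mapping.lookup c)"
    using m boundary_eq_0_iff_cycle[OF V] unfolding minimal_cycle_def is_cycle_def by blast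
  fix X assume X: "X \<subseteq> Poly_Mapping.keys c" "X \<noteq> {}"
    "cycle V (restrict_chain (Poly_Mapping.lookup c) X)"
  define b where "b = (\<Sum>F\<in>X. Poly_Mapping.single F (Poly_Mapping.lookup c F))"
  have finX: "finite X" by (rule finite_subset[OF X(1)]) simp
  have b: "Poly_Mapping.lookup b = restrict_chain (Poly_Mapping.lookup c) X"
  proof
    fix G
    have "Poly_Mapping.lookup b G = (\<Sum>F\<in>X. if F = G then Poly_Mapping.lookup c F else 0)"
      unfolding b_def lookup_sum by (rule sum.cong) (auto simp: lookup_single)
    then show "Poly_Mapping.lookup b G = restrict_chain (Poly_Mapping.lookup c) X G"
      using finX by (simp add: restrict_chain_def)
  qed
  have keys: "Poly_Mapping.keys b = X"
    unfolding supp_lookup[symmetric] b using X(1)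
    by (auto simp: supp_def restrict_chain_def in_keys_iff)
  have "boundary b = 0"
    using boundary_eq_0_iff_cycle[OF V(1), of b] V(2) X keys b by auto
  moreover have "is_chain i b"
    using m(1) X(1) keys unfolding minimal_cycle_def is_cycle_def is_chain_def by auto
  moreover have "subchain b c"
    unfolding subchain_def b restrict_chain_def by auto
  ultimately have "b = c \<or> b = 0"
    using m(1) unfolding minimal_cycle_def is_cycle_def by blast
  then show "X = Poly_Mapping.keys c" using keys X(2) by auto
qed

section \<open>Double counting over colour triples\<close>

lemma card_supersets:
  assumes "finite S" "X \<subseteq> S" "card X \<le> k"
  shows "card {T. T \<subseteq> S \<and> card T = k \<and> X \<subseteq> T} = (card S - card X) choose (k - card X)"
proof -
  have finX: "finite X" using assms finite_subset by blast
  have "bij_betw (\<lambda>T. T - X) {T. T \<subseteq> S \<and> card T = k \<and> X \<subseteq> T} {U. U \<subseteq> S - X \<and> card U = k - card X}"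
  proof (rule bij_betw_byWitness[of _ "\<lambda>U. U \<union> X"])
    show "(\<lambda>U. U \<union> X) ` {U. U \<subseteq> S - X \<and> card U = k - card X} \<subseteq> {T. T \<subseteq> S \<and> card T = k \<and> X \<subseteq> T}"
    proof clarify
      fix U assume U: "U \<subseteq> S - X" "card U = k - card X"
      then have "finite U" using assms(1) finite_subset by blast
      then have "card (U \<union> X) = card U + card X"
        using U finX by (intro card_Un_disjoint) auto
      then show "U \<union> X \<subseteq> S \<and> card (U \<union> X) = k \<and> X \<subseteq> U \<union> X" using U assms by auto
    qed
  qed (use finX in \<open>auto simp: card_Diff_subset\<close>)
  then have "card {T. T \<subseteq> S \<and> card T = k \<and> X \<subseteq> T} = card {U. U \<subseteq> S - X \<and> card U = k - card X}"
    by (rule bij_betw_same_card)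
  also have "\<dots> = card (S - X) choose (k - card X)"
    using assms by (intro n_subsets) auto
  finally show ?thesis using assms finX by (simp add: card_Diff_subset)
qed

lemma sum_card_swap:
  assumes "finite I" "finite J"
  shows "(\<Sum>i\<in>I. card {j \<in> J. P i j}) = (\<Sum>j\<in>J. card {i \<in> I. P i j})"
proof -
  have "card {j \<in> J. P i j} = (\<Sum>j\<in>J. if P i j then 1 else 0)" for i
    using assms by (simp add: sum.If_cases Int_def)
  moreover have "card {i \<in> I. P i j} = (\<Sum>i\<in>I. if P i j then 1 else 0)" for j
    using assms by (simp add: sum.If_cases Int_def)
  ultimately show ?thesis by (simp add: sum.swap[of _ J])
qed

text \<open>The facet is handed on because turning rigidity into an edge count needs a triangle in
  \<open>A\<close> to pin.\<close>

lemma typed_generic_rigid: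
  assumes mc: "minimal_cycle_complex TYPE('g::ab_group_add) i (\<Delta> :: 'v::linorder set set)"
    and fac: "\<forall>F\<in>\<Delta>. card F = i + 1 \<longrightarrow> card (F \<inter> A) = 3 \<and> card (F - A) = k"
    and A: "A \<subseteq> vertices \<Delta>"
  obtains F where "F \<in> \<Delta>" "card (F \<inter> A) = 3" "generic (rigid A \<Delta>)"
proof -
  consider F where "finite F" "card F = i + 1" "\<Delta> = generated_complex {F}"
    | c :: "'v set \<Rightarrow>\<^sub>0 'g" where "c \<noteq> 0" "minimal_cycle i c" "\<Delta> = generated_complex (Poly_Mapping.keys c)"
    using mc unfolding minimal_cycle_complex_def by blast
  then show thesis
  proof cases
    case 1
    then have F: "F \<in> \<Delta>" "vertices \<Delta> = F"
      unfolding generated_complex_def vertices_def by auto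
    then have "card (F \<inter> A) = 3" using fac 1 by blast
    moreover have "F \<inter> A = A" using A F by blast
    ultimately obtain x y z where xyz: "A = {x, y, z}" "distinct [x, y, z]"
      by (metis card_3_obtain)
    have "{{x, y}, {x, z}, {y, z}} \<subseteq> \<Delta>"
      using A F xyz 1(3) unfolding generated_complex_def by auto
    then have "generic (rigid A \<Delta>)"
      unfolding xyz(1) by (intro generic_mono[OF generic_nondeg[OF xyz(2)]] triangle_rigid)
    then show thesis using that F \<open>card (F \<inter> A) = 3\<close> by blast
  next
    case 2
    let ?K = "Poly_Mapping.keys c"
    have K: "finite F" "card F = i + 1" "F \<in> \<Delta>" if "F \<in> ?K" for F
      using 2(2,3) that unfolding minimal_cycle_def is_cycle_def is_chain_def generated_complex_def
      by auto
    have V: "vertices \<Delta> = \<Union>?K" unfolding 2(3) vertices_def generated_complex_def by auto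
    have fin: "finite (\<Union>?K)" using K(1) by simp
    have typed: "typed (\<Union>?K) A k ?K" unfolding typed_def using K(2,3) fac by auto
    have "min_cycle (\<Union>?K) (Poly_Mapping.lookup c)"
      by (rule minimal_cycle_imp_min_cycle[OF 2(2,1) fin]) auto
    from min_cycle_generic_rigid[OF fin this, unfolded supp_lookup, OF typed]
    have "generic (rigid (A \<inter> \<Union>?K) (generated_complex ?K))" .
    moreover have "A \<inter> \<Union>?K = A" using A V by blast
    moreover have "?K \<noteq> {}" using 2(1) by simp
    then obtain F where "F \<in> ?K" by blast
    moreover have "card (F \<inter> A) = 3" using K[OF \<open>F \<in> ?K\<close>] fac by blast
    ultimately show thesis using that[of F] K(3)[of F] 2(3) by simp
  qed
qed

lemma edge_count:
  assumes mc: "minimal_cycle_complex TYPE('g::ab_group_add) i (\<Delta> :: 'v::linorder set set)"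
    and fac: "\<forall>F\<in>\<Delta>. card F = i + 1 \<longrightarrow> card (F \<inter> A) = 3 \<and> card (F - A) = k"
    and A: "A \<subseteq> vertices \<Delta>"
  shows "3 * card A \<le> card (edges_in A \<Delta>) + 6"
proof -
  have sc: "finite (vertices \<Delta>)" "\<And>F G. F \<in> \<Delta> \<Longrightarrow> G \<subseteq> F \<Longrightarrow> G \<in> \<Delta>"
    using minimal_cycle_complex_def[THEN iffD1, OF mc, THEN conjunct1]
    unfolding simplicial_complex_def vertices_def by auto
  obtain F where F: "F \<in> \<Delta>" "card (F \<inter> A) = 3" "generic (rigid A \<Delta>)"
    using typed_generic_rigid[OF assms] .
  obtain x y z where xyz: "F \<inter> A = {x, y, z}" "distinct [x, y, z]"
    using card_3_obtain[OF F(2)] .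
  obtain p where p: "rigid A \<Delta> p" "nondeg p x y z"
    using generic_witness[OF generic_conj[OF F(3) generic_nondeg[OF xyz(2)]]] by blast
  show ?thesis
  proof (rule rigid_pinned_generic_and_count(2)[OF _ xyz(2) _ _ p(2,1)])
    show "finite A" using A sc(1) finite_subset by blast
    show "{x, y, z} \<subseteq> A" using xyz(1) by auto
    show "{{x, y}, {x, z}, {y, z}} \<subseteq> \<Delta>"
      using xyz(1) by (auto intro!: sc(2)[OF F(1)])
  qed
qed

theorem corollary4p4:
  fixes d :: nat and \<Delta> :: "'v::linorder set set"
  assumes "d \<ge> 3"
    and "minimal_cycle_complex TYPE('g::ab_group_add) (d - 1) \<Delta>"
    and "balanced d \<Delta>"
  shows "2 * h_num d \<Delta> 2 \<ge> (int d - 1) * h_num d \<Delta> 1"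
proof -
  have sc: "simplicial_complex \<Delta>" using assms(3) unfolding balanced_def by blast
  obtain \<kappa> :: "'v \<Rightarrow> nat" where \<kappa>: "\<kappa> ` vertices \<Delta> \<subseteq> {1..d}"
    "\<forall>F\<in>\<Delta>. \<forall>i\<in>{1..d}. card (F \<inter> \<kappa> -` {i}) \<le> 1"
    using assms(3) unfolding balanced_def by auto
  have fin: "finite \<Delta>" "finite (vertices \<Delta>)" "\<And>F. F \<in> \<Delta> \<Longrightarrow> finite F"
    using sc unfolding simplicial_complex_def vertices_def by auto
  have sub: "F \<subseteq> vertices \<Delta>" if "F \<in> \<Delta>" for F using that unfolding vertices_def by blast
  have inj: "inj_on \<kappa> F" if F: "F \<in> \<Delta>" for F
  proof (rule inj_onI)
    fix x y assume xy: "x \<in> F" "y \<in> F" "\<kappa> x = \<kappa> y"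
    have "\<kappa> x \<in> {1..d}" using \<kappa>(1) sub[OF F] xy by blast
    then have "card (F \<inter> \<kappa> -` {\<kappa> x}) \<le> 1" using \<kappa>(2) F by blast
    moreover have "card {x, y} \<le> card (F \<inter> \<kappa> -` {\<kappa> x})"
      using xy fin(3)[OF F] by (intro card_mono) auto
    ultimately show "x = y" by (auto simp: card_insert_if split: if_splits)
  qed
  define A where "A T = {x \<in> vertices \<Delta>. \<kappa> x \<in> T}" for T
  define E where "E = {e \<in> \<Delta>. card e = 2}"
  define \<T> where "\<T> = {T. T \<subseteq> {1..d} \<and> card T = 3}"
  have finT: "finite \<T>" unfolding \<T>_def by simp
  have main: "3 * card (A T) \<le> card {e \<in> E. \<kappa> ` e \<subseteq> T} + 6" if T: "T \<in> \<T>" for T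
  proof -
    have facets: "\<forall>F\<in>\<Delta>. card F = d - 1 + 1 \<longrightarrow> card (F \<inter> A T) = 3 \<and> card (F - A T) = d - 3"
    proof (intro ballI impI)
      fix F assume F: "F \<in> \<Delta>" "card F = d - 1 + 1"
      have F': "card F = d" using F assms(1) by simp
      \<comment> \<open>A facet has \<open>d\<close> vertices and repeats no colour, so every colour
        occurs on it.\<close>
      have "\<kappa> ` F = {1..d}"
        using \<kappa>(1) sub[OF F(1)] F' card_image[OF inj[OF F(1)]] by (intro card_subset_eq) auto
      then have "T \<subseteq> \<kappa> ` F" using T unfolding \<T>_def by blast
      moreover have "F \<inter> A T = {x \<in> F. \<kappa> x \<in> T}" using sub[OF F(1)] unfolding A_def by blast
      ultimately have "\<kappa> ` (F \<inter> A T) = T" by blast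
      moreover have "inj_on \<kappa> (F \<inter> A T)" by (rule inj_on_subset[OF inj[OF F(1)]]) auto
      ultimately have "card (F \<inter> A T) = 3"
        using T card_image[of \<kappa> "F \<inter> A T"] unfolding \<T>_def by simp
      moreover have "card (F - A T) = card F - card (F \<inter> A T)"
        by (rule card_Diff_subset_Int) (use fin(3)[OF F(1)] in simp)
      ultimately show "card (F \<inter> A T) = 3 \<and> card (F - A T) = d - 3" using F' by simp
    qed
    have "3 * card (A T) \<le> card (edges_in (A T) \<Delta>) + 6"
      by (rule edge_count[OF assms(2) facets]) (auto simp: A_def)
    moreover have "edges_in (A T) \<Delta> = {e \<in> E. \<kappa> ` e \<subseteq> T}"
      unfolding edges_in_def E_def A_def using sub by auto
    ultimately show ?thesis by simp
  qed
  have "(\<Sum>T\<in>\<T>. 3 * card (A T)) \<le> (\<Sum>T\<in>\<T>. card {e \<in> E. \<kappa> ` e \<subseteq> T} + 6)"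
    by (rule sum_mono) (rule main)
  moreover have "(\<Sum>T\<in>\<T>. card (A T)) = card (vertices \<Delta>) * ((d - 1) choose 2)"
  proof -
    have "(\<Sum>T\<in>\<T>. card (A T)) = (\<Sum>x\<in>vertices \<Delta>. card {T \<in> \<T>. \<kappa> x \<in> T})"
      unfolding A_def by (rule sum_card_swap[OF finT fin(2)])
    also have "\<dots> = (\<Sum>x\<in>vertices \<Delta>. (d - 1) choose 2)"
    proof (rule sum.cong[OF refl])
      fix x assume "x \<in> vertices \<Delta>"
      then show "card {T \<in> \<T>. \<kappa> x \<in> T} = (d - 1) choose 2"
        using card_supersets[of "{1..d}" "{\<kappa> x}" 3] \<kappa>(1) unfolding \<T>_def by auto
    qed
    finally show ?thesis by simp
  qed
  moreover have "(\<Sum>T\<in>\<T>. card {e \<in> E. \<kappa> ` e \<subseteq> T}) = card E * (d - 2)"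
  proof -
    have finE: "finite E" unfolding E_def using fin(1) by simp
    have "(\<Sum>T\<in>\<T>. card {e \<in> E. \<kappa> ` e \<subseteq> T}) = (\<Sum>e\<in>E. card {T \<in> \<T>. \<kappa> ` e \<subseteq> T})"
      by (rule sum_card_swap[OF finT finE])
    also have "\<dots> = (\<Sum>e\<in>E. d - 2)"
    proof (rule sum.cong[OF refl])
      fix e assume e: "e \<in> E"
      then have "e \<subseteq> vertices \<Delta>" "card (\<kappa> ` e) = 2"
        using card_image[OF inj] sub unfolding E_def by auto
      moreover from this have "\<kappa> ` e \<subseteq> {1..d}" using \<kappa>(1) by blast
      ultimately show "card {T \<in> \<T>. \<kappa> ` e \<subseteq> T} = d - 2"
        using card_supersets[of "{1..d}" "\<kappa> ` e" 3] unfolding \<T>_def by auto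
    qed
    finally show ?thesis by simp
  qed
  moreover have "card \<T> = d choose 3" unfolding \<T>_def by (simp add: n_subsets)
  ultimately have count: "3 * (card (vertices \<Delta>) * ((d - 1) choose 2)) \<le> card E * (d - 2) + 6 * (d choose 3)"
    by (simp add: sum.distrib sum_distrib_left[symmetric])
  \<comment> \<open>Writing \<open>d = m + 3\<close> removes truncated subtraction; the factor to be
    cancelled is \<open>m + 1\<close>, which is \<open>d - 2\<close>.\<close>
  obtain m where m: "d = m + 3" using assms(1) by (metis add.commute le_Suc_ex)
  have ch2: "2 * ((d - 1) choose 2) = (m + 1) * (m + 2)"
    unfolding m by (simp add: choose_two)
  have ch3: "6 * (d choose 3) = (m + 1) * (m + 2) * (m + 3)"
    unfolding m
  proof (induction m)
    case (Suc m)
    have "Suc m + 3 choose 3 = (m + 3 choose 3) + (m + 3 choose 2)"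
      by (simp add: numeral_3_eq_3 numeral_2_eq_2)
    moreover have "2 * (m + 3 choose 2) = (m + 2) * (m + 3)" by (simp add: choose_two)
    ultimately show ?case using Suc by (simp add: algebra_simps)
  qed (simp add: numeral_3_eq_3)
  have f0: "f_num \<Delta> 0 = card (vertices \<Delta>)"
  proof -
    have "{F \<in> \<Delta>. int (card F) = 0 + 1} = (\<lambda>x. {x}) ` vertices \<Delta>"
      using sc unfolding simplicial_complex_def vertices_def
      by (auto simp: card_1_singleton_iff)
    then show ?thesis unfolding f_num_def by (simp add: card_image)
  qed
  have f1: "f_num \<Delta> 1 = card E"
    unfolding f_num_def E_def by (rule arg_cong[of _ _ card]) auto
  have h1: "h_num d \<Delta> 1 = int (card (vertices \<Delta>)) - int d"
    using h_num_1[OF sc, of d] assms(1) f0 by simp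
  have h2: "h_num d \<Delta> 2
      = int (card E) - (int d - 1) * int (card (vertices \<Delta>)) + int (d choose 2)"
    using h_num_2[OF sc, of d] assms(1) f0 f1 by simp
  \<comment> \<open>Doubling clears the division in the binomial coefficient of \<open>ch2\<close>,
    so both sides show the factor \<open>m + 1\<close> over the naturals.\<close>
  have "(m + 1) * (3 * card (vertices \<Delta>) * (m + 2))
      = 2 * (3 * (card (vertices \<Delta>) * ((d - 1) choose 2)))"
    using arg_cong[OF ch2, of "\<lambda>x. 3 * card (vertices \<Delta>) * x"] by (simp only: ac_simps)
  also have "\<dots> \<le> 2 * (card E * (m + 1) + (m + 1) * (m + 2) * (m + 3))"
    using count unfolding ch3 by (simp add: m)
  also have "\<dots> = (m + 1) * (2 * card E + 2 * ((m + 2) * (m + 3)))"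
    by (simp add: algebra_simps)
  finally have "(m + 1) * (3 * card (vertices \<Delta>) * (m + 2))
      \<le> (m + 1) * (2 * card E + 2 * ((m + 2) * (m + 3)))" .
  then have "3 * card (vertices \<Delta>) * (m + 2) \<le> 2 * card E + 2 * ((m + 2) * (m + 3))"
    by (metis Suc_eq_plus1 mult_le_cancel1 zero_less_Suc)
  then have "3 * int (card (vertices \<Delta>)) * (int m + 2) \<le> 2 * int (card E) + 2 * ((int m + 2) * (int m + 3))"
    by (metis (mono_tags) of_nat_add of_nat_mult of_nat_numeral of_nat_le_iff)
  moreover have ch: "2 * int (d choose 2) = (int m + 3) * (int m + 2)"
  proof -
    have "even (d * (d - 1))" by (cases d) auto
    then have "2 * (d choose 2) = d * (d - 1)"
      unfolding choose_two by (rule dvd_mult_div_cancel)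
    from arg_cong[OF this, of int] show ?thesis by (simp add: m algebra_simps)
  qed
  ultimately show ?thesis
    unfolding h1 h2 by (simp add: m algebra_simps)
qed

end
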